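(* Let $\mathcal{C}$ be a covering of $\mathbb{R}^2$ by complete folding curves. Then $\mathcal{C}$ satisfies the local isomorphism property if and only if all the curves of $\mathcal{C}$ have the same type, satisfy $E_k(C)=E_k(C')$ for all $C,C'\in\mathcal{C}$ and all $k\in\mathbb{N}$, and have pairwise locally isomorphic associated sequences.
   Context: All sequences take values in $\{+1,-1\}$. For $S=(a_1,\dots,a_n)$ write $\overline{S}=(-a_n,\dots,-a_1)$. The $n$-folding sequences are defined recursively: the only $0$-folding sequence is the empty sequence, and the $(n+1)$-folding sequences are exactly $(\overline{S},+1,S)$ and $(\overline{S},-1,S)$ with $S$ an $n$-folding sequence. A subword of a sequence $(b_k)$ is a block $(b_{h+1},\dots,b_{h+m})$. A complete folding sequence is a sequence $(a_k)_{k\in\mathbb{Z}}$ each finite subword of which is a subword of some $n$-folding sequence. Two sequences indexed by $\mathbb{Z}$ are locally isomorphic if they have the same finite subwords. For a complete folding sequence $S=(a_h)$ and each $n\in\mathbb{N}$ there is $h_n$ with $a_{h_n+k2^{n+1}}=(-1)^k a_{h_n}$ for all $k\in\mathbb{Z}$; the set $E_n(S)=h_n+2^n\mathbb{Z}$ does not depend on the choice of $h_n$. A segment is an oriented unit edge of $\mathbb{Z}^2$. A complete curve is a sequence $C=(C_i)_{i\in\mathbb{Z}}$ of segments such that the terminal point of $C_i$ is the initial point of $C_{i+1}$, consecutive supports are perpendicular, and all supports are pairwise distinct (curves differing by an index shift are identified). Its associated sequence is $(\eta_i)_{i\in\mathbb{Z}}$ with $\eta_i=+1$ (resp. $-1$)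 if one turns left (resp. right) from $C_i$ to $C_{i+1}$. A complete folding curve is a complete curve whose associated sequence $S$ is a complete folding sequence; it has type $H$ (resp. $V$) if all segments $C_i$ with $i\in E_1(S)$ have horizontal (resp. vertical) supports. Let $\Lambda_{2k}=2^k\mathbb{Z}^2$, $\Lambda_{2k+1}=\mathbb{Z}(2^k,2^k)+\mathbb{Z}(2^k,-2^k)$; $E_n(C)=X+\Lambda_n$ where $X$ is the terminal point of any $C_i$ with $i\in E_n(S)$ (independent of $i$). A covering of $\mathbb{R}^2$ by complete folding curves is a set $\mathcal{C}$ of complete folding curves such that every unit edge of $\mathbb{Z}^2$ is the support of exactly one segment of exactly one curve of $\mathcal{C}$. A decorated segment of $\mathcal{C}$ is a segment of a curve of $\mathcal{C}$ together with, at each endpoint, the support of the segment of the same curve which precedes/follows it there. $\mathcal{C}$ satisfies the local isomorphism property if for every finite set $F$ of decorated segments of $\mathcal{C}$ there is $r>0$ such that every disk of radius $r$ contains a translate $v+F$ ($v\in\mathbb{Z}^2$) which is a set of decorated segments of $\mathcal{C}$. *)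

theory Defs
  imports "HOL-Analysis.Analysis" "HOL-Library.Sublist"
begin

subsection \<open>Folding sequences\<close>

definition bar :: "int list \<Rightarrow> int list" where
  "bar S = map uminus (rev S)"

inductive folding :: "nat \<Rightarrow> int list \<Rightarrow> bool" where
  folding_0: "folding 0 []"
| folding_pos: "folding n S \<Longrightarrow> folding (Suc n) (bar S @ [1] @ S)"
| folding_neg: "folding n S \<Longrightarrow> folding (Suc n) (bar S @ [-1] @ S)"

definition subwords :: "(int \<Rightarrow> int) \<Rightarrow> int list set" where
  "subwords a = {map (\<lambda>j. a (h + int j)) [1..<Suc m] | h m. True}"

definition complete_folding_seq :: "(int \<Rightarrow> int) \<Rightarrow> bool" where
  "complete_folding_seq a \<longleftrightarrow> (\<forall>w\<in>subwords a. \<exists>n S. folding n S \<and> sublist w S)"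

definition locally_isomorphic :: "(int \<Rightarrow> int) \<Rightarrow> (int \<Rightarrow> int) \<Rightarrow> bool" where
  "locally_isomorphic a b \<longleftrightarrow> subwords a = subwords b"

definition alternates_at :: "nat \<Rightarrow> (int \<Rightarrow> int) \<Rightarrow> int \<Rightarrow> bool" where
  "alternates_at n a h \<longleftrightarrow> (\<forall>k. a (h + k * 2 ^ (n + 1)) = (if even k then a h else - a h))"

text \<open>For a complete folding sequence an admissible \<open>h\<close> exists and the resulting coset
  does not depend on which one is chosen.\<close>

definition E_seq :: "nat \<Rightarrow> (int \<Rightarrow> int) \<Rightarrow> int set" where
  "E_seq n a = (let h = (SOME h. alternates_at n a h) in {h + k * 2 ^ n | k. True})"


subsection \<open>Segments and curves\<close>

type_synonym point = "int \<times> int"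

text \<open>A segment is the pair of its initial and its terminal point. A unit edge of the grid
  (the support of a segment) is represented by the set of its two endpoints.\<close>

type_synonym segment = "point \<times> point"
type_synonym edge = "point set"

definition dir :: "segment \<Rightarrow> point" where
  "dir s = snd s - fst s"

definition is_segment :: "segment \<Rightarrow> bool" where
  "is_segment s \<longleftrightarrow> dir s \<in> {(1, 0), (-1, 0), (0, 1), (0, -1)}"

definition support :: "segment \<Rightarrow> edge" where
  "support s = {fst s, snd s}"

definition unit_edges :: "edge set" where
  "unit_edges = {support s | s. is_segment s}"

definition horizontal :: "segment \<Rightarrow> bool" where
  "horizontal s \<longleftrightarrow> snd (dir s) = 0"

definition vertical :: "segment \<Rightarrow> bool" where
  "vertical s \<longleftrightarrow> fst (dir s) = 0"

definition perpendicular :: "segment \<Rightarrow> segment \<Rightarrow> bool" where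
  "perpendicular s t \<longleftrightarrow> fst (dir s) * fst (dir t) + snd (dir s) * snd (dir t) = 0"

definition left_turn :: "segment \<Rightarrow> segment \<Rightarrow> bool" where
  "left_turn s t \<longleftrightarrow> fst (dir s) * snd (dir t) - snd (dir s) * fst (dir t) > 0"

definition complete_curve :: "(int \<Rightarrow> segment) \<Rightarrow> bool" where
  "complete_curve C \<longleftrightarrow>
     (\<forall>i. is_segment (C i)) \<and>
     (\<forall>i. snd (C i) = fst (C (i + 1))) \<and>
     (\<forall>i. perpendicular (C i) (C (i + 1))) \<and>
     (\<forall>i j. i \<noteq> j \<longrightarrow> support (C i) \<noteq> support (C j))"

definition same_curve :: "(int \<Rightarrow> segment) \<Rightarrow> (int \<Rightarrow> segment) \<Rightarrow> bool" where
  "same_curve C D \<longleftrightarrow> (\<exists>m. \<forall>i. D i = C (i + m))"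

definition assoc_seq :: "(int \<Rightarrow> segment) \<Rightarrow> int \<Rightarrow> int" where
  "assoc_seq C i = (if left_turn (C i) (C (i + 1)) then 1 else -1)"

definition complete_folding_curve :: "(int \<Rightarrow> segment) \<Rightarrow> bool" where
  "complete_folding_curve C \<longleftrightarrow> complete_curve C \<and> complete_folding_seq (assoc_seq C)"

definition type_H :: "(int \<Rightarrow> segment) \<Rightarrow> bool" where
  "type_H C \<longleftrightarrow> (\<forall>i\<in>E_seq 1 (assoc_seq C). horizontal (C i))"

definition type_V :: "(int \<Rightarrow> segment) \<Rightarrow> bool" where
  "type_V C \<longleftrightarrow> (\<forall>i\<in>E_seq 1 (assoc_seq C). vertical (C i))"

definition Lam :: "nat \<Rightarrow> point set" where
  "Lam n = (let c = 2 ^ (n div 2) in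
     if even n then {(c * x, c * y) | x y. True}
     else {(x * c + y * c, x * c - y * c) | x y. True})"

text \<open>As for \<open>E_seq\<close>, the result does not depend on the chosen index \<open>i\<close>.\<close>

definition E_curve :: "nat \<Rightarrow> (int \<Rightarrow> segment) \<Rightarrow> point set" where
  "E_curve n C = (let i = (SOME i. i \<in> E_seq n (assoc_seq C)) in {snd (C i) + l | l. l \<in> Lam n})"


subsection \<open>Coverings\<close>

text \<open>A set of curves is given by a set of parametrizations; two parametrizations that differ
  by an index shift are the same curve, so that ``exactly one curve'' means uniqueness up
  to \<open>same_curve\<close>.\<close>

definition covering :: "(int \<Rightarrow> segment) set \<Rightarrow> bool" where
  "covering \<C> \<longleftrightarrow>
     (\<forall>C\<in>\<C>. complete_folding_curve C) \<and>
     (\<forall>e\<in>unit_edges. \<exists>C\<in>\<C>. (\<exists>!i. support (C i) = e) \<and>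
        (\<forall>D\<in>\<C>. (\<exists>i. support (D i) = e) \<longrightarrow> same_curve C D))"

text \<open>A segment with the support of its predecessor and the support of its successor.\<close>

type_synonym decorated = "segment \<times> edge \<times> edge"

definition decorated_segments :: "(int \<Rightarrow> segment) set \<Rightarrow> decorated set" where
  "decorated_segments \<C> =
     {(C i, support (C (i - 1)), support (C (i + 1))) | C i. C \<in> \<C>}"

fun translate :: "point \<Rightarrow> decorated \<Rightarrow> decorated" where
  "translate v ((p, q), e, f) = ((v + p, v + q), (+) v ` e, (+) v ` f)"

fun vertices :: "decorated \<Rightarrow> point set" where
  "vertices (s, e, f) = support s \<union> e \<union> f"

definition real_point :: "point \<Rightarrow> real \<times> real" where
  "real_point p = (real_of_int (fst p), real_of_int (snd p))"

text \<open>Disks are convex, so a disk contains a set of edges iff it contains their endpoints.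
  The metric on \<open>real \<times> real\<close> is the Euclidean one.\<close>

definition local_isomorphism_property :: "(int \<Rightarrow> segment) set \<Rightarrow> bool" where
  "local_isomorphism_property \<C> \<longleftrightarrow>
     (\<forall>F. finite F \<and> F \<subseteq> decorated_segments \<C> \<longrightarrow>
       (\<exists>r>0. \<forall>z :: real \<times> real. \<exists>v.
          translate v ` F \<subseteq> decorated_segments \<C> \<and>
          (\<forall>d \<in> translate v ` F. real_point ` vertices d \<subseteq> cball z r)))"

end

theory Submission
  imports Defs
begin

text \<open>Identify the plane with the Gaussian integers, so that \<open>Lam n\<close> is the ideal generated by
  \<open>(1 + i) ^ n\<close>. Keeping only the vertices of a folding path whose index lies in \<open>E_n\<close> gives
  a folding path with the same turns, scaled by a generator of \<open>Lam n\<close>; hence an index lies in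
  \<open>E_n\<close> iff its vertex lies in the corresponding coset of \<open>Lam n\<close>.

  If all curves agree on type, on the cosets \<open>E_n\<close> and on the subwords of their sequences, then the
  orientation of the edges and the turn at every vertex outside \<open>E_n\<close> are invariant under
  translation by \<open>Lam (n + 1)\<close>. A finite pattern therefore recurs along a lattice; a vertex lying in
  all \<open>E_n\<close>, which is unique, is replaced by one of large finite level with the same turn.

  Conversely, every folding path covers all edges of arbitrarily large disks. It arises by unfolding
  each edge of a coarser folding path into two, and two unfoldings double the radius of a disk all
  of whose vertices are visited twice; such a disk of radius \<open>1\<close> comes from a single vertex visited
  twice, provided its parity is right, and three equal consecutive turns yield such vertices in
  both parities. Given two curves \<open>C\<close> and \<open>D\<close>, the local isomorphism property moves long
  pieces of both by one vector into a disk covered by \<open>D\<close>, so \<open>C\<close> and \<open>D\<close> have the same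
  invariants.\<close>

subsection \<open>Folding sequences\<close>

lemma folding_induct [consumes 1, case_names Nil fold]:
  assumes "folding n S" and "Q 0 []"
    and "\<And>n S c. folding n S \<Longrightarrow> Q n S \<Longrightarrow> c \<in> {1, - 1} \<Longrightarrow> Q (Suc n) (bar S @ c # S)"
  shows "Q n S"
  using assms(1) by induction (use assms(2,3) in auto)

lemma folding_values: "folding n S \<Longrightarrow> set S \<subseteq> {1, - 1}"
  by (induction rule: folding_induct) (auto simp: bar_def)

lemma Suc_length_folding: "folding n S \<Longrightarrow> Suc (length S) = 2 ^ n"
  by (induction rule: folding_induct) (auto simp: bar_def)

lemma nth_folded_left:
  assumes "folding n S" "0 < p" "p < 2 ^ n"
  shows "(bar S @ c # S) ! (p - 1) = - S ! (2 ^ n - p - 1)"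
proof -
  have "p - 1 < length S" "length S - Suc (p - 1) = 2 ^ n - p - 1"
    using assms Suc_length_folding[OF assms(1)] by auto
  then show ?thesis by (simp add: bar_def nth_append rev_nth)
qed

lemma nth_folded_right:
  assumes "folding n S" "2 ^ n < p"
  shows "(bar S @ c # S) ! (p - 1) = S ! (p - 2 ^ n - 1)"
proof -
  have "p - 1 - length (bar S) = Suc (p - 2 ^ n - 1)" "\<not> p - 1 < length (bar S)"
    using assms(2) Suc_length_folding[OF assms(1)] by (auto simp: bar_def)
  then show ?thesis by (simp add: nth_append)
qed

lemma exponent_less_if_odd_multiple_less:
  fixes m n k :: nat
  assumes "2 ^ m * (2 * k + 3) < 2 * 2 ^ n"
  shows "m < n"
proof (rule ccontr)
  assume "\<not> m < n"
  then have "(2::nat) ^ n \<le> 2 ^ m" by (intro power_increasing) auto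
  then have "2 ^ n * 2 \<le> 2 ^ m * (2 * k + 3)" by (intro mult_le_mono) auto
  then show False using assms by simp
qed

text \<open>Counting from \<open>1\<close>, the position of an entry is \<open>2 ^ m\<close> times an odd number for exactly
  one \<open>m\<close>, the level of the entry.\<close>

lemma folding_level_alternates:
  "folding n S \<Longrightarrow> 2 ^ m * (2 * k + 3) \<le> length S \<Longrightarrow>
    S ! (2 ^ m * (2 * k + 3) - 1) = - S ! (2 ^ m * (2 * k + 1) - 1)"
proof (induction arbitrary: k rule: folding_induct)
  case (fold n S c)
  note left = nth_folded_left[OF fold.hyps(1)] and right = nth_folded_right[OF fold.hyps(1)]
  have length_S: "Suc (length S) = 2 ^ n" by (rule Suc_length_folding[OF fold.hyps(1)])
  have bound: "2 ^ m * (2 * k + 3) < 2 * 2 ^ n"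
    using fold.prems length_S by (simp add: bar_def)
  then have "m < n" by (rule exponent_less_if_odd_multiple_less)
  then obtain j where "n = Suc (m + j)" by (metis less_iff_Suc_add)
  then obtain r where half: "(2::nat) ^ n = 2 ^ m * (2 * r)" by (simp add: power_add)
  consider "k + 2 \<le> r" | "k + 1 = r" | "r \<le> k" by linarith
  then show ?case
  proof cases
    case 1
    then obtain i where r_eq: "r = k + 2 + i" by (metis le_Suc_ex)
    have "2 ^ m * (2 * i + 3) < 2 ^ m * (2 * r)"
      unfolding r_eq by (intro mult_strict_left_mono) auto
    then have "2 ^ m * (2 * i + 3) \<le> length S" using length_S half by linarith
    from fold.IH[OF this] show ?thesis
      using left[of "2 ^ m * (2 * k + 3)"] left[of "2 ^ m * (2 * k + 1)"] unfolding half r_eq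
      by (simp add: algebra_simps)
  next
    case 2
    then show ?thesis
      using left[of "2 ^ m * (2 * k + 1)"] right[of "2 ^ m * (2 * k + 3)"] unfolding half
      by (auto simp: algebra_simps)
  next
    case 3
    then obtain i where k_eq: "k = r + i" by (metis le_Suc_ex)
    have "2 ^ m * (2 * i + 3) + 2 ^ n = 2 ^ m * (2 * k + 3)"
      unfolding half k_eq by (simp add: algebra_simps)
    then have "2 ^ m * (2 * i + 3) \<le> length S" using bound length_S by linarith
    from fold.IH[OF this] show ?thesis
      using right[of "2 ^ m * (2 * k + 3)"] right[of "2 ^ m * (2 * k + 1)"] unfolding half k_eq
      by (simp add: algebra_simps)
  qed
qed simp

lemma subwords_iff: "w \<in> subwords a \<longleftrightarrow> (\<exists>h. \<forall>i<length w. w ! i = a (h + int i))"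
proof
  assume "w \<in> subwords a"
  then obtain h m where w_eq: "w = map (\<lambda>j. a (h + int j)) [1..<Suc m]"
    unfolding subwords_def by blast
  have "\<forall>i<length w. w ! i = a (h + 1 + int i)" unfolding w_eq by (simp add: add.assoc del: upt_Suc)
  then show "\<exists>h. \<forall>i<length w. w ! i = a (h + int i)" ..
next
  assume "\<exists>h. \<forall>i<length w. w ! i = a (h + int i)"
  then obtain h where "\<And>i. i < length w \<Longrightarrow> w ! i = a (h + int i)" by blast
  then have "w = map (\<lambda>j. a (h - 1 + int j)) [1..<Suc (length w)]"
    by (intro nth_equalityI) (simp_all add: algebra_simps del: upt_Suc)
  then show "w \<in> subwords a" unfolding subwords_def by blast
qed

definition window :: "nat \<Rightarrow> (int \<Rightarrow> int) \<Rightarrow> int list" where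
  "window M a = map (\<lambda>i. a (int i - int M)) [0..<Suc (2 * M)]"

lemma length_window: "length (window M a) = Suc (2 * M)"
  by (simp add: window_def)

lemma nth_window: "\<bar>x\<bar> \<le> int M \<Longrightarrow> window M a ! nat (x + int M) = a x"
  by (simp add: window_def nat_less_iff abs_le_iff del: upt_Suc)

lemma window_in_subwords: "window M a \<in> subwords a"
  unfolding subwords_iff length_window
  by (intro exI[of _ "- int M"]) (simp add: window_def del: upt_Suc)

lemma subwords_subset_iff:
  "subwords a \<subseteq> subwords b \<longleftrightarrow> (\<forall>M. \<exists>t. \<forall>x. \<bar>x\<bar> \<le> int M \<longrightarrow> b (t + x) = a x)"
proof (intro iffI allI subsetI)
  fix M assume "subwords a \<subseteq> subwords b"
  then have "window M a \<in> subwords b" using window_in_subwords by blast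
  then obtain h where entries: "\<And>i. i < Suc (2 * M) \<Longrightarrow> window M a ! i = b (h + int i)"
    unfolding subwords_iff length_window by blast
  have "b (h + int M + x) = a x" if "\<bar>x\<bar> \<le> int M" for x
  proof -
    have "nat (x + int M) < Suc (2 * M)" using that by auto
    from entries[OF this] show ?thesis using nth_window[OF that, of a] that
      by (simp add: abs_le_iff algebra_simps)
  qed
  then show "\<exists>t. \<forall>x. \<bar>x\<bar> \<le> int M \<longrightarrow> b (t + x) = a x" by blast
next
  fix w assume windows_occur: "\<forall>M. \<exists>t. \<forall>x. \<bar>x\<bar> \<le> int M \<longrightarrow> b (t + x) = a x" and "w \<in> subwords a"
  then obtain h where entries: "\<And>i. i < length w \<Longrightarrow> w ! i = a (h + int i)"
    unfolding subwords_iff by blast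
  obtain t where copy: "\<And>x. \<bar>x\<bar> \<le> int (nat \<bar>h\<bar> + length w) \<Longrightarrow> b (t + x) = a x"
    using windows_occur by blast
  have "w ! i = b (t + h + int i)" if "i < length w" for i
    using entries[OF that] copy[of "h + int i"] that by (simp add: add.assoc)
  then show "w \<in> subwords b" unfolding subwords_iff by blast
qed

lemma complete_folding_seq_window:
  assumes "complete_folding_seq a"
  obtains n S t where "folding n S"
    "\<And>x. \<bar>x\<bar> \<le> int M \<Longrightarrow> 0 < x + t \<and> x + t \<le> int (length S) \<and> a x = S ! nat (x + t - 1)"
proof -
  obtain n S where contains_window: "folding n S" "sublist (window M a) S"
    using assms window_in_subwords unfolding complete_folding_seq_def by blast
  then obtain ps ss where S_eq: "S = ps @ window M a @ ss" by (auto simp: sublist_def)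
  define t where "t = int M + int (length ps) + 1"
  have "0 < x + t \<and> x + t \<le> int (length S) \<and> a x = S ! nat (x + t - 1)"
    if in_window: "\<bar>x\<bar> \<le> int M" for x
  proof -
    have "nat (x + t - 1) = length ps + nat (x + int M)" using in_window by (auto simp: t_def)
    moreover have "nat (x + int M) < length (window M a)"
      using in_window by (auto simp: length_window)
    ultimately have "S ! nat (x + t - 1) = a x"
      using nth_window[OF in_window, of a] by (simp add: S_eq nth_append)
    then show ?thesis using in_window by (auto simp: t_def S_eq length_window)
  qed
  then show ?thesis using contains_window(1) that by blast
qed

lemma complete_folding_seq_values:
  assumes "complete_folding_seq a"
  shows "a x = 1 \<or> a x = - 1"
proof -
  obtain n S t where covers: "folding n S" "\<And>y. \<bar>y\<bar> \<le> int (nat \<bar>x\<bar>) \<Longrightarrow>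
      0 < y + t \<and> y + t \<le> int (length S) \<and> a y = S ! nat (y + t - 1)"
    using complete_folding_seq_window[OF assms] by metis
  have "a x \<in> set S" using covers(2)[of x] by (simp add: nat_less_iff)
  then show ?thesis using folding_values[OF covers(1)] by auto
qed

subsection \<open>The hierarchy of levels\<close>

text \<open>If \<open>a\<close> continues a folding sequence, \<open>c\<close> can be the place just before its first entry.\<close>

definition levels_alternate :: "nat \<Rightarrow> (int \<Rightarrow> int) \<Rightarrow> int \<Rightarrow> bool" where
  "levels_alternate n a c \<longleftrightarrow> (\<forall>m<n. alternates_at m a (c + 2 ^ m))"

lemma alternates_at_shift:
  assumes "alternates_at n a h" "2 ^ Suc n dvd d"
  shows "alternates_at n a (h + d)"
  unfolding alternates_at_def
proof
  fix k
  obtain j where "d = j * 2 ^ (n + 1)" using assms(2) by (metis Suc_eq_plus1 dvdE mult.commute)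
  then have "h + d + k * 2 ^ (n + 1) = h + (j + k) * 2 ^ (n + 1)" "h + d = h + j * 2 ^ (n + 1)"
    by (simp_all add: algebra_simps)
  then show "a (h + d + k * 2 ^ (n + 1)) = (if even k then a (h + d) else - a (h + d))"
    using assms(1) unfolding alternates_at_def by (metis even_add minus_minus)
qed

lemma alternates_atI:
  assumes "\<And>k. a (h + (k + 1) * 2 ^ (n + 1)) = - a (h + k * 2 ^ (n + 1))"
  shows "alternates_at n a h"
  unfolding alternates_at_def
proof
  show "a (h + k * 2 ^ (n + 1)) = (if even k then a h else - a h)" for k
  proof (induction k rule: int_induct[where k = 0])
    case (step1 i)
    then show ?case using assms[of i] by simp
  next
    case (step2 i)
    then show ?case using assms[of "i - 1"] by (simp split: if_splits)
  qed simp
qed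

lemma complete_folding_seq_window_levels:
  assumes "complete_folding_seq a"
  obtains t where "0 \<le> t" "t < 2 ^ n" "\<And>m k. m < n \<Longrightarrow> \<bar>2 ^ m * (2 * k + 1) - t\<bar> \<le> int M \<Longrightarrow>
    \<bar>2 ^ m * (2 * k + 3) - t\<bar> \<le> int M \<Longrightarrow> a (2 ^ m * (2 * k + 3) - t) = - a (2 ^ m * (2 * k + 1) - t)"
proof -
  obtain l S u where covers: "folding l S" "\<And>x. \<bar>x\<bar> \<le> int M \<Longrightarrow>
      0 < x + u \<and> x + u \<le> int (length S) \<and> a x = S ! nat (x + u - 1)"
    using complete_folding_seq_window[OF assms, of M] by metis
  define t where "t = u mod 2 ^ n"
  have "a (2 ^ m * (2 * k + 3) - t) = - a (2 ^ m * (2 * k + 1) - t)"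
    if level: "m < n" and lower: "\<bar>2 ^ m * (2 * k + 1) - t\<bar> \<le> int M"
      and upper: "\<bar>2 ^ m * (2 * k + 3) - t\<bar> \<le> int M"
    for m and k :: int
  proof -
    obtain i where "n = Suc (m + i)" using level by (metis less_iff_Suc_add)
    then have "u - t = 2 ^ m * (2 * (2 ^ i * (u div 2 ^ n)))"
      by (simp add: t_def minus_mod_eq_mult_div power_add algebra_simps)
    then obtain j where u_eq: "u - t = 2 ^ m * (2 * j)" by blast
    have positions: "2 ^ m * (2 * k + 1) - t + u = 2 ^ m * (2 * (k + j) + 1)"
      "2 ^ m * (2 * k + 3) - t + u = 2 ^ m * (2 * (k + j) + 3)"
        using u_eq by (simp_all add: algebra_simps)
    have "0 < 2 ^ m * (2 * (k + j) + 1)" using covers(2)[OF lower] unfolding positions by simp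
    then have "0 \<le> k + j" by (simp add: zero_less_mult_iff)
    then obtain q where q_eq: "k + j = int q" by (metis zero_le_imp_eq_int)
    have nat_positions: "nat (2 ^ m * (2 * int q + 1) - 1) = 2 ^ m * (2 * q + 1) - 1"
      "nat (2 ^ m * (2 * int q + 3) - 1) = 2 ^ m * (2 * q + 3) - 1"
      by (simp_all add: nat_diff_distrib' nat_mult_distrib nat_add_distrib nat_power_eq)
    have "int (2 ^ m * (2 * q + 3)) \<le> int (length S)"
      using covers(2)[OF upper] unfolding positions q_eq by simp
    then have "2 ^ m * (2 * q + 3) \<le> length S" by (simp only: of_nat_le_iff)
    from folding_level_alternates[OF covers(1) this] covers(2)[OF lower] covers(2)[OF upper]
    show ?thesis
      unfolding positions q_eq nat_positions by simp
  qed
  then show ?thesis using that[of t] by (simp add: t_def)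
qed

lemma complete_folding_seq_levels:
  assumes "complete_folding_seq a"
  shows "\<exists>c. levels_alternate n a c"
proof -
  define good where "good M t \<longleftrightarrow> (\<forall>m<n. \<forall>k. \<bar>2 ^ m * (2 * k + 1) - t\<bar> \<le> int M \<longrightarrow>
    \<bar>2 ^ m * (2 * k + 3) - t\<bar> \<le> int M \<longrightarrow>
    a (2 ^ m * (2 * k + 3) - t) = - a (2 ^ m * (2 * k + 1) - t))"
    for M and t :: int
  have "\<exists>t\<in>{0..<2 ^ n}. good M t" for M
    using complete_folding_seq_window_levels[OF assms, of n M] unfolding good_def
    by (metis atLeastLessThan_iff)
  then obtain f where offsets: "\<And>M. f M \<in> {0..<2 ^ n}" "\<And>M. good M (f M)" by metis
  obtain t where recurring: "infinite {M. f M = t}"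
  proof -
    have "finite (range f)"
      using offsets(1) by (meson finite_atLeastLessThan_int finite_subset image_subsetI)
    then show ?thesis using pigeonhole_infinite[OF infinite_UNIV_nat] that by auto
  qed
  have good: "good M t" for M
  proof -
    obtain M' where "M \<le> M'" "f M' = t"
      using recurring unfolding infinite_nat_iff_unbounded_le by auto
    then show ?thesis using offsets(2)[of M'] unfolding good_def by force
  qed
  have "alternates_at m a (- t + 2 ^ m)" if "m < n" for m
  proof (rule alternates_atI)
    fix k
    obtain M where "\<bar>2 ^ m * (2 * k + 1) - t\<bar> \<le> int M" "\<bar>2 ^ m * (2 * k + 3) - t\<bar> \<le> int M"
      using that[of "nat \<bar>2 ^ m * (2 * k + 1) - t\<bar> + nat \<bar>2 ^ m * (2 * k + 3) - t\<bar>"] by simp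
    then have "a (2 ^ m * (2 * k + 3) - t) = - a (2 ^ m * (2 * k + 1) - t)"
      using good[of M] that unfolding good_def by blast
    then show "a (- t + 2 ^ m + (k + 1) * 2 ^ (m + 1)) = - a (- t + 2 ^ m + k * 2 ^ (m + 1))"
      by (simp add: algebra_simps)
  qed
  then show ?thesis unfolding levels_alternate_def by blast
qed

lemma alternates_at_next: "alternates_at n a h \<Longrightarrow> a (h + 2 ^ Suc n) = - a h"
  unfolding alternates_at_def by (metis Suc_eq_plus1 mult_1 odd_one)

lemma alternates_at_period:
  assumes "alternates_at n a h" "2 ^ Suc (Suc n) dvd d"
  shows "a (h + d) = a h"
proof -
  obtain k where "d = (2 * k) * 2 ^ (n + 1)" using assms(2) by (auto simp: dvd_def mult_ac)
  then show ?thesis using assms(1) unfolding alternates_at_def by (metis dvd_triv_left)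
qed

lemma exact_power_of_two:
  fixes d :: int
  assumes "\<not> 2 ^ n dvd d"
  obtains m k where "m < n" "d = 2 ^ m * (2 * k + 1)"
proof -
  have "\<exists>m<n. \<exists>k. d = 2 ^ m * (2 * k + 1)" using assms
  proof (induction n)
    case (Suc n)
    show ?case
    proof (cases "2 ^ n dvd d")
      case True
      then obtain j where d_eq: "d = 2 ^ n * j" by (rule dvdE)
      then have "odd j" using Suc.prems by auto
      then show ?thesis using d_eq by (auto elim!: oddE)
    next
      case False
      then show ?thesis using Suc.IH less_Suc_eq by blast
    qed
  qed simp
  then show ?thesis using that by blast
qed

lemma levels_alternate_at:
  assumes "levels_alternate n a c" "m < n" "x - c = 2 ^ m * (2 * k + 1)"
  shows "alternates_at m a x"
proof -
  have "x = c + 2 ^ m + 2 ^ Suc m * k" using assms(3) by (simp add: algebra_simps)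
  then show ?thesis
    using assms(1,2) alternates_at_shift[of m a "c + 2 ^ m" "2 ^ Suc m * k"]
    unfolding levels_alternate_def by simp
qed

lemma levels_alternate_period:
  assumes "levels_alternate n a c" "\<not> 2 ^ n dvd x - c"
  shows "a (x + 2 ^ Suc n) = a x"
proof -
  obtain m k where level: "m < n" and position: "x - c = 2 ^ m * (2 * k + 1)"
    using exact_power_of_two[OF assms(2)] .
  have "(2::int) ^ Suc (Suc m) dvd 2 ^ Suc n" using level by (intro le_imp_power_dvd) simp
  then show ?thesis
    by (rule alternates_at_period[OF levels_alternate_at[OF assms(1) level position]])
qed

locale paperfolding =
  fixes a :: "int \<Rightarrow> int"
  assumes sign: "a x = 1 \<or> a x = - 1"
    and levels: "\<exists>c. levels_alternate n a c"
begin

lemma neq_uminus: "a x \<noteq> - a x"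
  using sign[of x] by auto

lemma four_alternations:
  assumes centre: "levels_alternate (Suc (Suc n)) a c"
    and alternations: "a (x + 2 ^ Suc n) = - a x" "a (x + 2 * 2 ^ Suc n) = a x"
      "a (x + 3 * 2 ^ Suc n) = - a x"
  shows "2 ^ Suc n dvd x - (c + 2 ^ n)"
proof -
  have "levels_alternate n a c" using centre unfolding levels_alternate_def by simp
  then have "2 ^ n dvd x - c"
    using levels_alternate_period alternations(1) neq_uminus[of x] by metis
  then obtain j where position: "x - c = 2 ^ n * j" by (rule dvdE)
  have "odd j"
  proof
    assume "even j"
    then obtain i where "j = 2 * i" by (rule evenE)
    then have even_position: "x - c = 2 ^ Suc n * i" using position by simp
    show False
    proof (cases "even i")
      case True
      then obtain k where "i = 2 * k" by (rule evenE)
      then have "x + 2 ^ Suc n - c = 2 ^ Suc n * (2 * k + 1)"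
        using even_position by (simp add: algebra_simps)
      from alternates_at_next[OF levels_alternate_at[OF centre _ this]]
      have "a (x + 3 * 2 ^ Suc n) = - a (x + 2 ^ Suc n)" by (simp add: algebra_simps)
      then show False using alternations(1,3) neq_uminus[of x] by simp
    next
      case False
      then obtain k where "i = 2 * k + 1" by (rule oddE)
      then have "x - c = 2 ^ Suc n * (2 * k + 1)" using even_position by simp
      from alternates_at_next[OF levels_alternate_at[OF centre _ this]]
      show False using alternations(2) neq_uminus[of x] by simp
    qed
  qed
  then obtain i where "j = 2 * i + 1" by (rule oddE)
  then have "x - (c + 2 ^ n) = 2 ^ Suc n * i" using position by (simp add: algebra_simps)
  then show ?thesis by simp
qed

lemma alternates_at_iff:
  assumes "levels_alternate (Suc (Suc n)) a c"
  shows "alternates_at n a x \<longleftrightarrow> 2 ^ Suc n dvd x - (c + 2 ^ n)"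
proof
  assume alternating: "alternates_at n a x"
  have "a (x + k * 2 ^ Suc n) = (if even k then a x else - a x)" for k
    using alternating unfolding alternates_at_def by simp
  from this[of 1] this[of 2] this[of 3] show "2 ^ Suc n dvd x - (c + 2 ^ n)"
    by (intro four_alternations[OF assms]) simp_all
next
  assume "2 ^ Suc n dvd x - (c + 2 ^ n)"
  moreover have "alternates_at n a (c + 2 ^ n)" using assms unfolding levels_alternate_def by simp
  ultimately show "alternates_at n a x" using alternates_at_shift by fastforce
qed

lemma E_seq_eq:
  assumes "alternates_at n a h"
  shows "E_seq n a = {x. 2 ^ n dvd x - h}"
proof -
  obtain c where centre: "levels_alternate (Suc (Suc n)) a c" using levels by blast
  define g where "g = (SOME h. alternates_at n a h)"
  have "alternates_at n a g" unfolding g_def using assms by (rule someI)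
  then have "2 ^ Suc n dvd g - (c + 2 ^ n)" "2 ^ Suc n dvd h - (c + 2 ^ n)"
    using assms alternates_at_iff[OF centre] by blast+
  from dvd_diff[OF this] have g_cong_h: "2 ^ n dvd g - h" by (simp add: dvd_mult_right)
  have "x = g + k * 2 ^ n \<longleftrightarrow> x - g = 2 ^ n * k" for x k by (auto simp: algebra_simps)
  then have "E_seq n a = {x. 2 ^ n dvd x - g}" unfolding E_seq_def g_def Let_def dvd_def by auto
  also have "\<dots> = {x. 2 ^ n dvd x - h}" using dvd_add_left_iff[OF g_cong_h, of "_ - g"] by simp
  finally show ?thesis .
qed

lemma E_seq_dvd:
  assumes "levels_alternate (Suc (Suc n)) a c" "m \<le> n"
  shows "x \<in> E_seq m a \<longleftrightarrow> 2 ^ m dvd x - c"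
proof -
  have "alternates_at m a (c + 2 ^ m)" using assms unfolding levels_alternate_def by simp
  from E_seq_eq[OF this] show ?thesis
    using dvd_add_left_iff[of "2 ^ m" "2 ^ m" "x - (c + 2 ^ m)"] by (simp add: algebra_simps)
qed

lemma E_seq_iff:
  assumes "x \<in> E_seq n a"
  shows "y \<in> E_seq n a \<longleftrightarrow> 2 ^ n dvd y - x"
proof -
  obtain c where centre: "levels_alternate (Suc (Suc n)) a c" using levels by blast
  show ?thesis
    using assms dvd_add_left_iff[of "2 ^ n" "x - c" "y - x"]
      unfolding E_seq_dvd[OF centre order_refl]
    by simp
qed

lemma E_seq_ex_small:
  obtains x where "x \<in> E_seq n a" "0 \<le> x" "x < 2 ^ n"
proof -
  obtain c where centre: "levels_alternate (Suc (Suc n)) a c" using levels by blast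
  have "2 ^ n dvd c mod 2 ^ n - c" by (simp flip: mod_eq_dvd_iff)
  then have "c mod 2 ^ n \<in> E_seq n a" unfolding E_seq_dvd[OF centre order_refl] .
  then show ?thesis using that[of "c mod 2 ^ n"] by simp
qed

lemma E_seq_0: "E_seq 0 a = UNIV"
proof -
  obtain x where "x \<in> E_seq 0 a" using E_seq_ex_small[of 0] .
  from E_seq_iff[OF this] show ?thesis by auto
qed

lemma E_seq_antimono:
  assumes "m \<le> n"
  shows "E_seq n a \<subseteq> E_seq m a"
proof -
  obtain c where centre: "levels_alternate (Suc (Suc n)) a c" using levels by blast
  show ?thesis
    using E_seq_dvd[OF centre assms] E_seq_dvd[OF centre order_refl] power_le_dvd[OF _ assms]
      by blast
qed

lemma E_seq_SucD: "x \<in> E_seq (Suc n) a \<Longrightarrow> x \<in> E_seq n a"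
  using E_seq_antimono[of n "Suc n"] by auto

lemma E_seq_add: "x \<in> E_seq n a \<Longrightarrow> x + k * 2 ^ n \<in> E_seq n a"
  using E_seq_iff[of x n "x + k * 2 ^ n"] by simp

lemma E_seq_half:
  assumes "x \<in> E_seq n a"
  shows "x + 2 ^ n \<in> E_seq (Suc n) a \<longleftrightarrow> x \<notin> E_seq (Suc n) a"
    and "x - 2 ^ n \<in> E_seq (Suc n) a \<longleftrightarrow> x \<notin> E_seq (Suc n) a"
proof -
  obtain c where centre: "levels_alternate (Suc (Suc (Suc n))) a c" using levels by blast
  have "2 ^ n dvd x - c" using assms E_seq_dvd[OF centre, of n] by simp
  then obtain k where "x - c = 2 ^ n * k" by (rule dvdE)
  then have "x - c = 2 ^ n * k" "x + 2 ^ n - c = 2 ^ n * (k + 1)" "x - 2 ^ n - c = 2 ^ n * (k - 1)"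
    by (simp_all add: algebra_simps)
  then show "x + 2 ^ n \<in> E_seq (Suc n) a \<longleftrightarrow> x \<notin> E_seq (Suc n) a"
    and "x - 2 ^ n \<in> E_seq (Suc n) a \<longleftrightarrow> x \<notin> E_seq (Suc n) a"
    unfolding E_seq_dvd[OF centre order_refl] power_Suc2 by simp_all
qed

lemma alternates_at_exact_level:
  assumes "x \<in> E_seq n a" "x \<notin> E_seq (Suc n) a"
  shows "alternates_at n a x"
proof -
  obtain c where centre: "levels_alternate (Suc (Suc (Suc n))) a c" using levels by blast
  then have alternating: "alternates_at n a (c + 2 ^ n)" unfolding levels_alternate_def by simp
  have "x - 2 ^ n \<in> E_seq (Suc n) a" using E_seq_half(2) assms by blast
  then have "2 ^ Suc n dvd x - (c + 2 ^ n)"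
    unfolding E_seq_dvd[OF centre order_refl] by (simp add: algebra_simps)
  from alternates_at_shift[OF alternating this] show ?thesis by simp
qed

lemma exact_level:
  assumes "i \<notin> E_seq n a"
  obtains m where "m < n" "i \<in> E_seq m a" "i \<notin> E_seq (Suc m) a"
proof -
  have "i \<in> E_seq 0 a" by (simp add: E_seq_0)
  from ex_least_nat_less[of "\<lambda>k. i \<notin> E_seq k a", OF assms] this that show ?thesis by blast
qed

lemma E_seq_sign:
  assumes "i \<in> E_seq (Suc (Suc m)) a"
  shows "a (i - 2 ^ m) = - a (i + 2 ^ m)"
    and "j \<in> E_seq (Suc (Suc m)) a \<Longrightarrow> a (j + 2 ^ m) = a (i + 2 ^ m)"
proof -
  have lower_levels: "i \<in> E_seq (Suc m) a" "i \<in> E_seq m a" using assms E_seq_SucD by blast+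
  have "i - 2 ^ m \<in> E_seq m a" "i - 2 ^ m \<notin> E_seq (Suc m) a"
    using E_seq_add[OF lower_levels(2), of "- 1"] E_seq_half(2)[OF lower_levels(2)] lower_levels(1)
      by simp_all
  from alternates_at_next[OF alternates_at_exact_level[OF this]]
  show "a (i - 2 ^ m) = - a (i + 2 ^ m)" by (simp add: add.commute)
  show "a (j + 2 ^ m) = a (i + 2 ^ m)" if "j \<in> E_seq (Suc (Suc m)) a"
  proof -
    have "i + 2 ^ m \<in> E_seq m a" "i + 2 ^ m \<notin> E_seq (Suc m) a"
      using E_seq_add[OF lower_levels(2), of 1] E_seq_half(1)[OF lower_levels(2)] lower_levels(1)
        by simp_all
    then have "alternates_at m a (i + 2 ^ m)" by (rule alternates_at_exact_level)
    moreover have "2 ^ Suc (Suc m) dvd j - i" using E_seq_iff[OF assms] that by blast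
    ultimately have "a (i + 2 ^ m + (j - i)) = a (i + 2 ^ m)" by (rule alternates_at_period)
    then show ?thesis by (simp add: algebra_simps)
  qed
qed

lemma paperfolding_decimation:
  assumes "e \<in> E_seq 1 a"
  shows "paperfolding (\<lambda>i. a (e + 2 * i))"
proof
  show "a (e + 2 * i) = 1 \<or> a (e + 2 * i) = - 1" for i by (rule sign)
  show "\<exists>c. levels_alternate n (\<lambda>i. a (e + 2 * i)) c" for n
  proof -
    obtain c where centre: "levels_alternate (Suc (Suc (Suc n))) a c" using levels by blast
    have "even (e - c)" using assms E_seq_dvd[OF centre, of 1] by simp
    then obtain b where "e - c = 2 * b" by (rule evenE)
    then have c_eq: "c = e + 2 * - b" by simp
    have "alternates_at m (\<lambda>i. a (e + 2 * i)) (- b + 2 ^ m)" if "m < n" for m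
    proof -
      have "alternates_at (Suc m) a (c + 2 ^ Suc m)"
        using centre that unfolding levels_alternate_def by (simp del: power_Suc)
      then have "alternates_at (Suc m) a (e + 2 * (- b + 2 ^ m))"
        unfolding c_eq by (simp add: algebra_simps)
      then show ?thesis unfolding alternates_at_def by (simp add: algebra_simps)
    qed
    then show ?thesis unfolding levels_alternate_def by blast
  qed
qed

end

lemma complete_folding_seq_imp_paperfolding: "complete_folding_seq a \<Longrightarrow> paperfolding a"
  by unfold_locales (simp_all add: complete_folding_seq_values complete_folding_seq_levels)

lemma E_seq_window:
  assumes "paperfolding a" "paperfolding b"
    and copy: "\<And>x. \<bar>x\<bar> \<le> 2 ^ (n + 4) \<Longrightarrow> b (t + x) = a x"
  shows "t + x \<in> E_seq n b \<longleftrightarrow> x \<in> E_seq n a"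
proof -
  interpret a: paperfolding a by fact
  interpret b: paperfolding b by fact
  obtain c where centre: "levels_alternate (Suc (Suc n)) a c" using a.levels by blast
  define g where "g = (c + 2 ^ n) mod 2 ^ Suc n"
  have g_alternates: "alternates_at n a g"
    unfolding a.alternates_at_iff[OF centre] g_def by (simp flip: mod_eq_dvd_iff del: power_Suc)
  have g_bounds: "0 \<le> g" "g < 2 ^ Suc n"
    unfolding g_def by (auto intro: pos_mod_bound simp del: power_Suc)
  have alternation: "b (t + g + k * 2 ^ Suc n) = (if even k then a g else - a g)"
    if "0 \<le> k" "k \<le> 3" for k
  proof -
    have "k * 2 ^ Suc n \<le> 3 * 2 ^ Suc n" using that by (intro mult_right_mono) auto
    moreover have "0 \<le> k * 2 ^ Suc n" using that by auto
    moreover have "(2::int) ^ (n + 4) = 8 * 2 ^ Suc n" by (simp add: power_add)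
    ultimately have "\<bar>g + k * 2 ^ Suc n\<bar> \<le> 2 ^ (n + 4)" using g_bounds by linarith
    then have "b (t + (g + k * 2 ^ Suc n)) = a (g + k * 2 ^ Suc n)" using copy by blast
    also have "\<dots> = (if even k then a g else - a g)"
      using g_alternates unfolding alternates_at_def by simp
    finally show ?thesis by (simp add: add.assoc)
  qed
  obtain d where centre_b: "levels_alternate (Suc (Suc n)) b d" using b.levels by blast
  have "2 ^ Suc n dvd t + g - (d + 2 ^ n)"
    using alternation[of 0] alternation[of 1] alternation[of 2] alternation[of 3]
      by (intro b.four_alternations[OF centre_b]) simp_all
  then have "alternates_at n b (t + g)" unfolding b.alternates_at_iff[OF centre_b] .
  then show ?thesis using b.E_seq_eq a.E_seq_eq[OF g_alternates] by simp
qed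

lemma subwords_subset_imp_sign_eq:
  assumes "paperfolding a" "paperfolding b" and sub: "subwords a \<subseteq> subwords b"
    and level_i: "i \<in> E_seq (Suc (Suc m)) a" and level_j: "j \<in> E_seq (Suc (Suc m)) b"
  shows "b (j + 2 ^ m) = a (i + 2 ^ m)"
proof -
  interpret a: paperfolding a by fact
  interpret b: paperfolding b by fact
  let ?M = "2 ^ (Suc (Suc m) + 4) :: int"
  obtain t where copy: "\<And>x. \<bar>x\<bar> \<le> ?M \<Longrightarrow> b (t + x) = a x"
    using sub unfolding subwords_subset_iff by (metis of_nat_numeral of_nat_power)
  obtain x where small: "x \<in> E_seq (Suc (Suc m)) a" "0 \<le> x" "x < 2 ^ Suc (Suc m)"
    by (rule a.E_seq_ex_small)
  have "t + x \<in> E_seq (Suc (Suc m)) b" using E_seq_window[OF assms(1,2) copy] small(1) by blast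
  then have "b (j + 2 ^ m) = b (t + x + 2 ^ m)" using b.E_seq_sign(2)[OF _ level_j] by blast
  also have "\<dots> = b (t + (x + 2 ^ m))" by (simp add: add.assoc)
  also have "\<dots> = a (x + 2 ^ m)"
  proof (rule copy)
    have "?M = 64 * 2 ^ m" "(2::int) ^ Suc (Suc m) = 4 * 2 ^ m" by (simp_all add: power_add)
    then show "\<bar>x + 2 ^ m\<bar> \<le> ?M" using small(2,3) zero_less_power[of "2::int" m] by linarith
  qed
  also have "\<dots> = a (i + 2 ^ m)" by (rule a.E_seq_sign(2)[OF level_i small(1)])
  finally show ?thesis .
qed

subsection \<open>The ideals generated by powers of \<open>1 + i\<close>\<close>

definition rot :: "int \<Rightarrow> point \<Rightarrow> point" where
  "rot s p = (- s * snd p, s * fst p)"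

text \<open>Multiplication by \<open>1 + i\<close> in the Gaussian integers, as \<open>rot 1\<close> is multiplication by \<open>i\<close>.\<close>

definition spread :: "point \<Rightarrow> point" where
  "spread p = p + rot 1 p"

definition unit_vectors :: "point set" where
  "unit_vectors = {(1, 0), (- 1, 0), (0, 1), (0, - 1)}"

lemma rot_add: "rot s (p + q) = rot s p + rot s q"
  and rot_diff: "rot s (p - q) = rot s p - rot s q"
  and rot_minus: "rot s (- p) = - rot s p"
  and rot_uminus: "rot (- s) p = - rot s p"
  and rot_commute: "rot s (rot t p) = rot t (rot s p)"
  by (simp_all add: rot_def prod_eq_iff algebra_simps)

lemma rot_rot: "s = 1 \<or> s = - 1 \<Longrightarrow> rot s (rot s p) = - p"
  by (auto simp: rot_def prod_eq_iff)

lemma rot_unit_vector: "s = 1 \<or> s = - 1 \<Longrightarrow> rot s d \<in> unit_vectors \<longleftrightarrow> d \<in> unit_vectors"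
  by (auto simp: rot_def unit_vectors_def prod_eq_iff)

lemma minus_unit_vector: "- d \<in> unit_vectors \<longleftrightarrow> d \<in> unit_vectors"
  by (auto simp: unit_vectors_def prod_eq_iff)

lemma is_segment_iff: "is_segment s \<longleftrightarrow> dir s \<in> unit_vectors"
  by (simp add: is_segment_def unit_vectors_def)

lemma spread_add: "spread (p + q) = spread p + spread q"
  and spread_diff: "spread (p - q) = spread p - spread q"
  and spread_minus: "spread (- p) = - spread p"
  and spread_rot: "spread (rot s p) = rot s (spread p)"
  by (simp_all add: spread_def rot_add rot_diff rot_minus rot_commute)

lemma spread_0: "spread 0 = 0"
  by (simp add: spread_def rot_def prod_eq_iff)

lemma spread_inject: "spread p = spread q \<longleftrightarrow> p = q"
  by (auto simp: spread_def rot_def prod_eq_iff)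

lemma Lam_0: "Lam 0 = UNIV"
  by (auto simp: Lam_def)

lemma Lam_Suc: "Lam (Suc n) = spread ` Lam n"
proof -
  define c :: int where "c = 2 ^ (n div 2)"
  have even_case: "(x * c + y * c, x * c - y * c) = spread (c * x, c * - y)" for x y
    by (simp add: spread_def rot_def)
  have odd_case: "(2 * c * x, 2 * c * y) = spread (y * c + x * c, y * c - x * c)" for x y
    by (simp add: spread_def rot_def)
  show ?thesis
  proof (cases "even n")
    case True
    then have Lam: "Lam n = {(c * x, c * y) | x y. True}"
      "Lam (Suc n) = {(x * c + y * c, x * c - y * c) | x y. True}"
      by (simp_all add: Lam_def c_def Let_def)
    have "\<exists>u v. spread (c * x, c * y) = spread (c * u, c * - v)" for x y
      by (intro exI[of _ x] exI[of _ "- y"]) simp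
    then show ?thesis unfolding Lam even_case by blast
  next
    case False
    then have Lam: "Lam n = {(x * c + y * c, x * c - y * c) | x y. True}"
      "Lam (Suc n) = {(2 * c * x, 2 * c * y) | x y. True}"
      by (simp_all add: Lam_def c_def Let_def)
    show ?thesis unfolding Lam odd_case by blast
  qed
qed

lemma spread_in_Lam: "spread p \<in> Lam (Suc n) \<longleftrightarrow> p \<in> Lam n"
  by (auto simp: Lam_Suc spread_inject)

lemma Lam_zero: "0 \<in> Lam n"
proof (induction n)
  case (Suc n)
  then show ?case using spread_in_Lam[of 0 n] by (simp add: spread_0)
qed (simp add: Lam_0)

lemma Lam_add: "p \<in> Lam n \<Longrightarrow> q \<in> Lam n \<Longrightarrow> p + q \<in> Lam n"
proof (induction n arbitrary: p q)
  case (Suc n)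
  then obtain p' q' where "p = spread p'" "q = spread q'" "p' \<in> Lam n" "q' \<in> Lam n"
    by (auto simp: Lam_Suc)
  then show ?case using Suc.IH by (simp add: spread_in_Lam flip: spread_add)
qed (simp add: Lam_0)

lemma Lam_rot: "s = 1 \<or> s = - 1 \<Longrightarrow> rot s p \<in> Lam n \<longleftrightarrow> p \<in> Lam n"
proof -
  assume sign: "s = 1 \<or> s = - 1"
  have closed: "rot t q \<in> Lam n" if "q \<in> Lam n" for t q
    using that
  proof (induction n arbitrary: q)
    case (Suc n)
    then obtain q' where "q = spread q'" "q' \<in> Lam n" by (auto simp: Lam_Suc)
    then show ?case using Suc.IH by (simp add: spread_in_Lam flip: spread_rot)
  qed (simp add: Lam_0)
  have "rot (- s) (rot s p) = p" using rot_rot[OF sign] by (simp add: rot_uminus)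
  then show ?thesis using closed[of p s] closed[of "rot s p" "- s"] by auto
qed

lemma Lam_minus: "- p \<in> Lam n \<longleftrightarrow> p \<in> Lam n"
  using Lam_rot[of 1 p n] Lam_rot[of 1 "rot 1 p" n] by (simp add: rot_rot)

lemma Lam_diff: "p \<in> Lam n \<Longrightarrow> q \<in> Lam n \<Longrightarrow> p - q \<in> Lam n"
  using Lam_add[of p n "- q"] by (simp add: Lam_minus)

lemma Lam_add_iff: "q \<in> Lam n \<Longrightarrow> p + q \<in> Lam n \<longleftrightarrow> p \<in> Lam n"
  using Lam_diff[of "p + q" n q] Lam_add[of p n q] by auto

lemma Lam_turn: "s = 1 \<or> s = - 1 \<Longrightarrow> p + rot s p \<in> Lam (Suc n) \<longleftrightarrow> p \<in> Lam n"
proof (elim disjE)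
  assume "s = - 1"
  moreover have "p + rot (- 1) p = rot (- 1) (spread p)"
    by (simp add: rot_def spread_def prod_eq_iff)
  ultimately show ?thesis by (simp add: Lam_rot spread_in_Lam)
qed (simp add: spread_in_Lam flip: spread_def)

lemma Lam_antimono: "m \<le> n \<Longrightarrow> Lam n \<subseteq> Lam m"
proof (rule lift_Suc_antimono_le)
  show "Lam (Suc n) \<subseteq> Lam n" for n
  proof (induction n)
    case (Suc n)
    then show ?case unfolding Lam_Suc[of "Suc n"] Lam_Suc[of n] by (simp add: image_mono)
  qed (simp add: Lam_0)
qed

lemma Lam_SucD: "p \<in> Lam (Suc n) \<Longrightarrow> p \<in> Lam n"
  using Lam_antimono[of n "Suc n"] by auto

lemma Lam_1_iff: "p \<in> Lam (Suc 0) \<longleftrightarrow> even (fst p + snd p)"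
proof -
  have "p \<in> Lam (Suc 0) \<longleftrightarrow> (\<exists>u v. fst p = u + v \<and> snd p = u - v)"
    by (auto simp: Lam_def prod_eq_iff)
  also have "\<dots> \<longleftrightarrow> even (fst p + snd p)"
  proof
    assume "even (fst p + snd p)"
    then obtain u where "fst p + snd p = 2 * u" by (rule evenE)
    then have "fst p = u + (u - snd p) \<and> snd p = u - (u - snd p)" by simp
    then show "\<exists>u v. fst p = u + v \<and> snd p = u - v" by blast
  qed auto
  finally show ?thesis .
qed

lemma Lam_index_two:
  "p \<in> Lam n \<Longrightarrow> p \<notin> Lam (Suc n) \<Longrightarrow> q \<in> Lam n \<Longrightarrow> p + q \<in> Lam (Suc n) \<longleftrightarrow> q \<notin> Lam (Suc n)"
proof (induction n arbitrary: p q)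
  case 0
  then show ?case by (auto simp: Lam_1_iff)
next
  case (Suc n)
  then obtain p' q' where roots: "p = spread p'" "q = spread q'" "p' \<in> Lam n" "q' \<in> Lam n"
    by (auto simp: Lam_Suc[of n])
  then show ?case using Suc.IH[of p' q'] Suc.prems by (simp add: spread_in_Lam flip: spread_add)
qed

lemma unit_vector_notin_Lam: "d \<in> unit_vectors \<Longrightarrow> d \<notin> Lam (Suc 0)"
  by (auto simp: Lam_1_iff unit_vectors_def)

lemma scaled_in_Lam: "(2 ^ n * x, 2 ^ n * y) \<in> Lam n"
proof -
  have "(2 ^ n * x, 2 ^ n * y) \<in> Lam (2 * n)" by (auto simp: Lam_def Let_def)
  then show ?thesis using Lam_antimono[of n "2 * n"] by auto
qed

lemma eq_zero_if_in_all_Lam: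
  assumes "\<And>n. p \<in> Lam n"
  shows "p = 0"
proof -
  have "z = 0" if divisible: "\<And>n::nat. 2 ^ n dvd z" for z :: int
  proof (rule ccontr)
    assume "z \<noteq> 0"
    then have "2 ^ nat \<bar>z\<bar> \<le> \<bar>z\<bar>" using dvd_imp_le_int[OF _ divisible[of "nat \<bar>z\<bar>"]] by simp
    moreover have "int (nat \<bar>z\<bar>) < 2 ^ nat \<bar>z\<bar>"
      by (metis less_exp of_nat_less_iff of_nat_numeral of_nat_power)
    ultimately show False by simp
  qed
  moreover have "2 ^ n dvd fst p" "2 ^ n dvd snd p" for n :: nat
    using assms[of "2 * n"] by (auto simp: Lam_def Let_def)
  ultimately show ?thesis by (simp add: prod_eq_iff)
qed

subsection \<open>Folding paths\<close>

locale folding_path = paperfolding a for a :: "int \<Rightarrow> int" +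
  fixes P :: "int \<Rightarrow> point"
  assumes step: "P (i + 1) - P i \<in> unit_vectors"
    and turn: "P (i + 1) - P i = rot (a i) (P i - P (i - 1))"
begin

text \<open>Skipping all vertices of level below \<open>m\<close> gives again a folding path, with the same turns.\<close>

lemma coarse_turn:
  "j \<in> E_seq m a \<Longrightarrow> P (j + 2 * 2 ^ m) - P (j + 2 ^ m) = rot (a (j + 2 ^ m)) (P (j + 2 ^ m) - P j)"
proof (induction m arbitrary: j)
  case 0
  then show ?case using turn[of "j + 1"] by (simp add: add.assoc)
next
  case (Suc m)
  have level_j: "j \<in> E_seq m a" using Suc.prems E_seq_SucD by blast
  have level_j1: "j + 2 ^ m \<in> E_seq m a" using E_seq_add[OF level_j, of 1] by simp
  have level_j2: "j + 2 * 2 ^ m \<in> E_seq m a" using E_seq_add[OF level_j, of 2] by simp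
  have "j + 2 ^ m \<notin> E_seq (Suc m) a" using E_seq_half(1)[OF level_j] Suc.prems by blast
  from alternates_at_next[OF alternates_at_exact_level[OF level_j1 this]]
  have alternating: "a (j + 2 * 2 ^ m + 2 ^ m) = - a (j + 2 ^ m)" by (simp add: algebra_simps)
  let ?p = "\<lambda>k. P (j + k * 2 ^ m)" and ?s = "a (j + 2 ^ m)" and ?t = "a (j + 2 * 2 ^ m)"
  have first: "?p 2 - ?p 1 = rot ?s (?p 1 - ?p 0)" using Suc.IH[OF level_j] by simp
  have second: "?p 3 - ?p 2 = rot ?t (?p 2 - ?p 1)"
    using Suc.IH[OF level_j1] by (simp add: algebra_simps)
  have third: "?p 4 - ?p 3 = - rot ?s (?p 3 - ?p 2)"
    using Suc.IH[OF level_j2] unfolding alternating by (simp add: rot_uminus algebra_simps)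
  have "?p 4 - ?p 2 = (?p 3 - ?p 2) + (?p 4 - ?p 3)" by simp
  also have "\<dots> = rot ?t (?p 2 - ?p 1) - rot ?t (rot ?s (?p 2 - ?p 1))"
    unfolding third second by (simp add: rot_commute)
  also have "rot ?s (?p 2 - ?p 1) = - (?p 1 - ?p 0)" unfolding first by (rule rot_rot[OF sign])
  finally show ?case by (simp add: rot_add rot_diff rot_minus algebra_simps)
qed

lemma coarse_step_split:
  assumes "j \<in> E_seq m a"
  shows "P (j + 2 ^ Suc m) - P j =
    (P (j + 2 ^ m) - P j) + rot (a (j + 2 ^ m)) (P (j + 2 ^ m) - P j)"
  by (simp flip: coarse_turn[OF assms])

lemma coarse_step_Lam:
  "j \<in> E_seq m a \<Longrightarrow> P (j + 2 ^ m) - P j \<in> Lam m \<and> P (j + 2 ^ m) - P j \<notin> Lam (Suc m)"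
proof (induction m arbitrary: j)
  case 0
  show ?case using unit_vector_notin_Lam[OF step] by (simp add: Lam_0)
next
  case (Suc m)
  then have level_j: "j \<in> E_seq m a" using E_seq_SucD by blast
  show ?case unfolding coarse_step_split[OF level_j] using Suc.IH[OF level_j] Lam_turn[OF sign]
    by blast
qed

lemma coarse_vertices_Lam:
  assumes "j \<in> E_seq m a"
  shows "P (j + k * 2 ^ m) - P j \<in> Lam m \<and> (P (j + k * 2 ^ m) - P j \<in> Lam (Suc m) \<longleftrightarrow> even k)"
proof (induction k rule: int_induct[where k = 0])
  case base
  then show ?case by (simp add: Lam_zero)
next
  case (step1 i)
  let ?s = "P (j + i * 2 ^ m + 2 ^ m) - P (j + i * 2 ^ m)"
  let ?r = "P (j + i * 2 ^ m) - P j"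
  have odd_step: "?s \<in> Lam m" "?s \<notin> Lam (Suc m)"
    using coarse_step_Lam[OF E_seq_add[OF assms]] by blast+
  have split: "P (j + (i + 1) * 2 ^ m) - P j = ?s + ?r" by (simp add: algebra_simps)
  show ?case unfolding split
    using step1 Lam_index_two[OF odd_step, of ?r] Lam_add[OF odd_step(1), of ?r] by simp
next
  case (step2 i)
  let ?s = "P (j + (i - 1) * 2 ^ m + 2 ^ m) - P (j + (i - 1) * 2 ^ m)"
  let ?r = "P (j + i * 2 ^ m) - P j"
  have odd_step: "- ?s \<in> Lam m" "- ?s \<notin> Lam (Suc m)"
    unfolding Lam_minus using coarse_step_Lam[OF E_seq_add[OF assms]] by blast+
  have split: "P (j + (i - 1) * 2 ^ m) - P j = - ?s + ?r" by (simp add: algebra_simps)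
  show ?case unfolding split
    using step2 Lam_index_two[OF odd_step, of ?r] Lam_add[OF odd_step(1), of ?r] by simp
qed

lemma E_seq_iff_vertex:
  "j \<in> E_seq m a \<Longrightarrow> i \<in> E_seq m a \<longleftrightarrow> P i - P j \<in> Lam m"
proof (induction m)
  case 0
  then show ?case by (simp add: E_seq_0 Lam_0)
next
  case (Suc m)
  have level_j: "j \<in> E_seq m a" using Suc.prems E_seq_SucD by blast
  show ?case
  proof (cases "i \<in> E_seq m a")
    case True
    then have "2 ^ m dvd i - j" using E_seq_iff[OF level_j] by blast
    then obtain k where "i - j = 2 ^ m * k" by (rule dvdE)
    then have i_eq: "i = j + k * 2 ^ m" by (simp add: algebra_simps)
    have "i \<in> E_seq (Suc m) a \<longleftrightarrow> even k" using E_seq_iff[OF Suc.prems, of i] by (simp add: i_eq)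
    then show ?thesis using coarse_vertices_Lam[OF level_j, of k] unfolding i_eq by blast
  next
    case False
    then show ?thesis using Suc.IH[OF level_j] Lam_SucD E_seq_SucD by blast
  qed
qed

end

subsection \<open>A folding path covers arbitrarily large disks\<close>

definition traverses :: "(int \<Rightarrow> point) \<Rightarrow> point \<Rightarrow> point \<Rightarrow> bool" where
  "traverses P u v \<longleftrightarrow> (\<exists>i. {P i, P (i + 1)} = {u, v})"

definition saturated :: "(int \<Rightarrow> point) \<Rightarrow> point \<Rightarrow> bool" where
  "saturated P x \<longleftrightarrow> (\<forall>d\<in>unit_vectors. traverses P x (x + d))"

text \<open>An edge from \<open>x\<close> in direction \<open>d\<close> is unfolded into two edges from \<open>q + spread x\<close> to
  \<open>q + spread (x + d)\<close>. As \<open>spread d = d + rot 1 d\<close>, the first of these two edges has direction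
  \<open>d\<close> or \<open>rot 1 d\<close>; the parity of \<open>x\<close> decides which because the turns at the corners alternate.\<close>

definition bend_sign :: "bool \<Rightarrow> point \<Rightarrow> int" where
  "bend_sign b x = (if (x \<in> Lam (Suc 0)) = b then 1 else - 1)"

definition bend :: "bool \<Rightarrow> point \<Rightarrow> point \<Rightarrow> point" where
  "bend b x d = (if bend_sign b x = 1 then rot 1 d else d)"

definition unfolds :: "(int \<Rightarrow> point) \<Rightarrow> (int \<Rightarrow> point) \<Rightarrow> point \<Rightarrow> bool \<Rightarrow> bool" where
  "unfolds P' P q b \<longleftrightarrow> (\<forall>x. \<forall>d\<in>unit_vectors. traverses P' x (x + d) \<longrightarrow>
     traverses P (q + spread x) (q + spread x + bend b x d))"

lemma traverses_commute: "traverses P u v \<longleftrightarrow> traverses P v u"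
  by (simp add: traverses_def insert_commute)

lemma traverses_step: "traverses P (P i) (P (i + 1))"
  unfolding traverses_def by blast

lemma unit_vectors_eq:
  assumes "d \<in> unit_vectors"
  shows "unit_vectors = {d, - d, rot 1 d, - rot 1 d}"
  using assms by (auto simp: unit_vectors_def rot_def)

lemma Lam_1_add_unit_vector:
  "d \<in> unit_vectors \<Longrightarrow> x + d \<in> Lam (Suc 0) \<longleftrightarrow> x \<notin> Lam (Suc 0)"
  by (auto simp: Lam_1_iff unit_vectors_def)

lemma bend_sign_cases: "bend_sign b x = 1 \<or> bend_sign b x = - 1"
  by (simp add: bend_sign_def)

lemma bend_sign_add: "d \<in> unit_vectors \<Longrightarrow> bend_sign b (x + d) = - bend_sign b x"
  by (auto simp: bend_sign_def Lam_1_add_unit_vector)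

lemma bend_unit_vector: "bend b x d \<in> unit_vectors \<longleftrightarrow> d \<in> unit_vectors"
  by (simp add: bend_def rot_unit_vector)

lemma bend_minus: "bend b x (- d) = - bend b x d"
  by (simp add: bend_def rot_minus)

lemma bend_surj:
  assumes "w \<in> unit_vectors"
  obtains d where "d \<in> unit_vectors" "bend b x d = w"
proof (cases "bend_sign b x = 1")
  case True
  then show ?thesis using that[of "- rot 1 w"] assms
    by (simp add: bend_def rot_minus rot_rot minus_unit_vector rot_unit_vector)
next
  case False
  then show ?thesis using that[of w] assms by (simp add: bend_def)
qed

lemma spread_bend: "spread d = bend b x d + bend b (x + d) d" if "d \<in> unit_vectors"
  using bend_sign_cases[of b x] by (auto simp: bend_def bend_sign_add[OF that] spread_def)

lemma twice_bend: "bend b x d + bend b x d = spread (d + rot (bend_sign b x) d)"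
  using bend_sign_cases[of b x]
  by (auto simp: bend_def spread_add spread_rot spread_def[of d] rot_add rot_uminus rot_rot)

lemma unfolds_corner:
  assumes "unfolds P' P q b" "d \<in> unit_vectors" "traverses P' x (x + d)"
  shows "traverses P (q + spread x + bend b x d) (q + spread x)"
    and "traverses P (q + spread x + bend b x d) (q + spread (x + d))"
proof -
  show "traverses P (q + spread x + bend b x d) (q + spread x)"
    using assms traverses_commute unfolding unfolds_def by blast
  have "traverses P' (x + d) (x + d + - d)" using assms(3) traverses_commute by simp
  then have "traverses P (q + spread (x + d)) (q + spread (x + d) + bend b (x + d) (- d))"
    using assms(1,2) minus_unit_vector unfolding unfolds_def by blast
  moreover have "spread (x + d) + bend b (x + d) (- d) = spread x + bend b x d"
    by (simp add: spread_add spread_bend[OF assms(2), of b x] bend_minus)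
  ultimately show "traverses P (q + spread x + bend b x d) (q + spread (x + d))"
    by (simp add: traverses_commute add.assoc)
qed

lemma unfolds_saturated_even:
  assumes "unfolds P' P q b" "saturated P' x"
  shows "saturated P (q + spread x)"
  unfolding saturated_def
proof
  fix w assume "w \<in> unit_vectors"
  then obtain d where "d \<in> unit_vectors" "bend b x d = w" by (rule bend_surj)
  then show "traverses P (q + spread x) (q + spread x + w)"
    using assms unfolding unfolds_def saturated_def by blast
qed

text \<open>The corners of the unfolded edges are the centres of the unit squares of \<open>P'\<close>, and opposite
  sides of a unit square either both bend towards its centre or both bend away from it.\<close>

lemma unfolds_opposite_edges:
  assumes unfold: "unfolds P' P q b" and unit_d: "d \<in> unit_vectors"
    and y_eq: "y = x + d + rot (bend_sign b x) d"
    and edges: "traverses P' x (x + d)" "traverses P' y (y - d)"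
  shows "saturated P (q + spread x + bend b x d)"
proof -
  let ?c = "q + spread x + bend b x d"
  have "rot (bend_sign b x) d \<in> unit_vectors"
    using rot_unit_vector[OF bend_sign_cases] unit_d by blast
  then have "bend_sign b y = bend_sign b x" by (simp add: y_eq bend_sign_add unit_d)
  then have "bend b y (- d) = - bend b x d" by (simp add: bend_def rot_minus)
  moreover have spread_y: "spread y = spread x + bend b x d + bend b x d"
    unfolding y_eq add.assoc twice_bend spread_add ..
  ultimately have same_corner: "q + spread y + bend b y (- d) = ?c" by (simp add: add.assoc)
  have "traverses P ?c (q + spread x)" "traverses P ?c (q + spread (x + d))"
    "traverses P ?c (q + spread y)" "traverses P ?c (q + spread (y - d))"
    using unfolds_corner[OF unfold unit_d edges(1)]
      unfolds_corner[OF unfold _ edges(2)[unfolded diff_conv_add_uminus]] unit_d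
    unfolding same_corner by (simp_all add: minus_unit_vector)
  then show ?thesis
    unfolding saturated_def unit_vectors_eq[OF unit_d] spread_add spread_diff spread_y bend_def
      spread_def[of d]
    by (auto simp: algebra_simps)
qed

lemma unfolds_saturated_odd:
  assumes unfold: "unfolds P' P q b" and unit_w: "w \<in> unit_vectors"
    and sat: "saturated P' x" "saturated P' y" and opposite: "spread y = spread x + w + w"
  shows "saturated P (q + spread x + w)"
proof -
  obtain d where bend_d: "d \<in> unit_vectors" "bend b x d = w" using bend_surj[OF unit_w] .
  have "spread y = spread (x + d + rot (bend_sign b x) d)"
    unfolding opposite bend_d(2)[symmetric] add.assoc twice_bend spread_add ..
  then have "y = x + d + rot (bend_sign b x) d" unfolding spread_inject .
  moreover have "traverses P' x (x + d)" using sat(1) bend_d(1) unfolding saturated_def by blast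
  moreover have "traverses P' y (y - d)"
    using sat(2) bend_d(1) minus_unit_vector unfolding saturated_def diff_conv_add_uminus by blast
  ultimately show ?thesis using unfolds_opposite_edges[OF unfold bend_d(1)] bend_d(2) by blast
qed

lemma unfolds_saturated_region:
  assumes unfold: "unfolds P' P q b" and sat: "\<And>y. R (spread y) \<Longrightarrow> saturated P' (p + y)"
    and even: "u \<in> Lam (Suc 0) \<Longrightarrow> R u"
    and odd: "u \<notin> Lam (Suc 0) \<Longrightarrow> \<exists>w\<in>unit_vectors. R (u - w) \<and> R (u + w)"
  shows "saturated P (q + spread p + u)"
proof (cases "u \<in> Lam (Suc 0)")
  case True
  then obtain y where "u = spread y" by (auto simp: Lam_Suc)
  then show ?thesis
    using unfolds_saturated_even[OF unfold sat, of y] even[OF True]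
      by (simp add: spread_add add.assoc)
next
  case False
  then obtain w where neighbours: "w \<in> unit_vectors" "R (u - w)" "R (u + w)" using odd by blast
  have "u + w \<in> Lam (Suc 0)" "u - w \<in> Lam (Suc 0)"
    using False Lam_1_add_unit_vector[of w u] Lam_1_add_unit_vector[of "- w" u] neighbours(1)
    by (simp_all add: minus_unit_vector)
  then obtain x y where spread_xy: "u - w = spread x" "u + w = spread y" by (auto simp: Lam_Suc)
  have "spread y = spread x + w + w" by (simp flip: spread_xy)
  then have "saturated P (q + spread (p + x) + w)"
    using neighbours sat unfolding spread_xy
    by (intro unfolds_saturated_odd[OF unfold, of _ _ "p + y"]) (simp_all add: spread_add add.assoc)
  then show ?thesis by (simp add: spread_add add.assoc flip: spread_xy)
qed

definition square_saturated :: "int \<Rightarrow> (int \<Rightarrow> point) \<Rightarrow> point \<Rightarrow> bool" where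
  "square_saturated n P p \<longleftrightarrow> (\<forall>u. \<bar>fst u\<bar> \<le> n \<and> \<bar>snd u\<bar> \<le> n \<longrightarrow> saturated P (p + u))"

definition diamond_saturated :: "int \<Rightarrow> (int \<Rightarrow> point) \<Rightarrow> point \<Rightarrow> bool" where
  "diamond_saturated n P p \<longleftrightarrow> (\<forall>u. \<bar>fst u\<bar> + \<bar>snd u\<bar> \<le> n \<longrightarrow> saturated P (p + u))"

lemma fst_spread: "fst (spread p) = fst p - snd p"
  and snd_spread: "snd (spread p) = fst p + snd p"
  by (simp_all add: spread_def rot_def)

lemma unfolds_square_saturated:
  assumes unfold: "unfolds P' P q b" and sat: "diamond_saturated n P' p"
  shows "square_saturated n P (q + spread p)"
  unfolding square_saturated_def
proof (intro allI impI)
  fix u :: point assume in_square: "\<bar>fst u\<bar> \<le> n \<and> \<bar>snd u\<bar> \<le> n"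
  show "saturated P (q + spread p + u)"
  proof (rule unfolds_saturated_region[OF unfold])
    fix y assume "\<bar>fst (spread y)\<bar> \<le> n \<and> \<bar>snd (spread y)\<bar> \<le> n"
    then have "\<bar>fst y\<bar> + \<bar>snd y\<bar> \<le> n" by (simp add: fst_spread snd_spread) linarith
    then show "saturated P' (p + y)" using sat unfolding diamond_saturated_def by blast
  next
    assume "u \<notin> Lam (Suc 0)"
    then have "odd (\<bar>fst u\<bar> + \<bar>snd u\<bar>)" by (simp add: Lam_1_iff)
    then have "\<bar>fst u\<bar> < n \<or> \<bar>snd u\<bar> < n" using in_square by (metis even_add order_le_less)
    then show "\<exists>w\<in>unit_vectors. (\<bar>fst (u - w)\<bar> \<le> n \<and> \<bar>snd (u - w)\<bar> \<le> n) \<and>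
        (\<bar>fst (u + w)\<bar> \<le> n \<and> \<bar>snd (u + w)\<bar> \<le> n)"
      using in_square by (intro bexI[of _ "if \<bar>fst u\<bar> < n then (1, 0) else (0, 1)"])
        (auto simp: unit_vectors_def)
  qed (rule in_square)
qed

lemma unfolds_diamond_saturated:
  assumes unfold: "unfolds P' P q b" and sat: "square_saturated n P' p"
  shows "diamond_saturated (2 * n) P (q + spread p)"
  unfolding diamond_saturated_def
proof (intro allI impI)
  fix u :: point assume in_diamond: "\<bar>fst u\<bar> + \<bar>snd u\<bar> \<le> 2 * n"
  show "saturated P (q + spread p + u)"
  proof (rule unfolds_saturated_region[OF unfold])
    fix y assume "\<bar>fst (spread y)\<bar> + \<bar>snd (spread y)\<bar> \<le> 2 * n"
    then have "\<bar>fst y\<bar> \<le> n \<and> \<bar>snd y\<bar> \<le> n" by (simp add: fst_spread snd_spread) linarith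
    then show "saturated P' (p + y)" using sat unfolding square_saturated_def by blast
  next
    assume "u \<notin> Lam (Suc 0)"
    then have "odd (\<bar>fst u\<bar> + \<bar>snd u\<bar>)" by (simp add: Lam_1_iff)
    then have "\<bar>fst u\<bar> + \<bar>snd u\<bar> < 2 * n" using in_diamond by (metis dvd_triv_left order_le_less)
    then show "\<exists>w\<in>unit_vectors. \<bar>fst (u - w)\<bar> + \<bar>snd (u - w)\<bar> \<le> 2 * n \<and>
        \<bar>fst (u + w)\<bar> + \<bar>snd (u + w)\<bar> \<le> 2 * n"
      by (intro bexI[of _ "(1, 0)"]) (auto simp: unit_vectors_def)
  qed (rule in_diamond)
qed

text \<open>After one unfolding the four edges at a saturated vertex become a pinwheel. If the second
  unfolding bends them in the same sense, the arms of the pinwheel meet.\<close>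

lemma unfolds_twice_neighbour:
  assumes unfold': "unfolds P'' P' q' b'" and unfold: "unfolds P' P q b" and sat: "saturated P'' x"
    and same: "bend_sign b' x = bend_sign b (q' + spread x)" and unit_d: "d \<in> unit_vectors"
  shows "saturated P (q + spread (q' + spread x) + bend b (q' + spread x) d)"
proof -
  let ?x = "q' + spread x"
  let ?s = "bend_sign b ?x"
  define d' where "d' = (if ?s = 1 then d else rot (- 1) d)"
  have unit_d': "d' \<in> unit_vectors" using unit_d by (simp add: d'_def rot_unit_vector)
  then have arm: "traverses P'' x (x + d')" using sat unfolding saturated_def by blast
  have "?x + bend b' x d' = ?x + d + rot ?s d - d"
    using bend_sign_cases[of b ?x] by (auto simp: bend_def same d'_def rot_uminus rot_minus rot_rot)
  moreover have "q' + spread (x + d') = ?x + d + rot ?s d"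
    using bend_sign_cases[of b ?x]
    by (auto simp: d'_def spread_add spread_minus spread_rot spread_def[of d] rot_add rot_uminus
        rot_rot)
  ultimately have "traverses P' (?x + d + rot ?s d) (?x + d + rot ?s d - d)"
    using unfolds_corner(2)[OF unfold' unit_d' arm] traverses_commute by metis
  moreover have "traverses P' ?x (?x + d)"
    using unfolds_saturated_even[OF unfold' sat] unit_d unfolding saturated_def by blast
  ultimately show ?thesis by (intro unfolds_opposite_edges[OF unfold unit_d refl])
qed

lemma unfolds_twice_saturated:
  assumes unfold': "unfolds P'' P' q' b'" and unfold: "unfolds P' P q b" and sat: "saturated P'' x"
    and same: "bend_sign b' x = bend_sign b (q' + spread x)"
  shows "diamond_saturated 1 P (q + spread (q' + spread x))"
  unfolding diamond_saturated_def
proof (intro allI impI)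
  let ?x = "q' + spread x"
  fix u :: point
  assume "\<bar>fst u\<bar> + \<bar>snd u\<bar> \<le> 1"
  then have "u = 0 \<or> u \<in> unit_vectors" by (auto simp: unit_vectors_def prod_eq_iff)
  then show "saturated P (q + spread ?x + u)"
  proof
    assume "u = 0"
    then show ?thesis using unfolds_saturated_even[OF unfold unfolds_saturated_even[OF unfold' sat]]
      by simp
  next
    assume "u \<in> unit_vectors"
    then obtain d where "d \<in> unit_vectors" "bend b ?x d = u" by (rule bend_surj)
    then show ?thesis using unfolds_twice_neighbour[OF unfold' unfold sat same, of d] by simp
  qed
qed

lemma (in paperfolding) alternates_at_after_E_seq_1:
  assumes "e \<in> E_seq 1 a"
  shows "alternates_at 0 a (e + 1)"
  using assms E_seq_half(1)[of e 0] E_seq_0 by (intro alternates_at_exact_level) simp_all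

lemma (in paperfolding) exists_equal_adjacent_signs:
  "\<exists>g\<in>E_seq 1 a. a (g + 1) = a g \<and> a (g + 4) = - a g"
proof -
  obtain h where level_h: "h \<in> E_seq (Suc (Suc 0)) a" using E_seq_ex_small .
  define g where "g = h + 2"
  have level_g: "g \<in> E_seq (Suc 0) a" "g \<notin> E_seq (Suc (Suc 0)) a"
    using E_seq_add[OF E_seq_SucD[OF level_h], of 1] E_seq_half(1)[OF E_seq_SucD[OF level_h]]
      level_h
    by (simp_all add: g_def)
  have alternating: "alternates_at (Suc 0) a g" by (rule alternates_at_exact_level[OF level_g])
  have "a (g + 4) = - a g" "a (g + 8) = a g"
    using alternates_at_next[OF alternating] alternates_at_period[OF alternating, of 8] by simp_all
  moreover have "a (g + 5) = a (g + 1)"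
    using alternates_at_period[OF alternates_at_after_E_seq_1, of g 4] level_g(1)
    by (simp add: add.commute)
  moreover have "g + 4 \<in> E_seq 1 a" using E_seq_add[OF level_g(1), of 2] by simp
  ultimately show ?thesis
    using level_g(1) sign[of g] sign[of "g + 1"]
    by (intro bexI[of _ "if a (g + 1) = a g then g else g + 4"]) (auto simp: add.assoc)
qed

lemma (in paperfolding) exists_three_equal_signs: "\<exists>j\<in>E_seq 1 a. a (j + 1) = a j \<and> a (j + 2) = a j"
proof -
  obtain g where adjacent: "g \<in> E_seq 1 a" "a (g + 1) = a g" "a (g + 4) = - a g"
    using exists_equal_adjacent_signs by blast
  have third: "a (g + 3) = - a g"
    using alternates_at_next[OF alternates_at_after_E_seq_1[OF adjacent(1)]] adjacent(2)
      by (simp add: add.assoc)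
  show ?thesis
  proof (cases "a (g + 2) = a g")
    case True
    then show ?thesis using adjacent by blast
  next
    case False
    then have "a (g + 2) = - a g" using sign[of g] sign[of "g + 2"] by auto
    moreover have "g + 2 \<in> E_seq 1 a" using E_seq_add[OF adjacent(1), of 1] by simp
    ultimately show ?thesis using adjacent(3) third
      by (intro bexI[of _ "g + 2"]) (simp_all add: add.assoc)
  qed
qed

lemma spread_eq_add_rot_iff:
  "s = 1 \<or> s = - 1 \<Longrightarrow> spread d = v + rot s v \<longleftrightarrow> d = (if s = 1 then v else rot (- 1) v)"
proof -
  assume "s = 1 \<or> s = - 1"
  then have "v + rot s v = spread (if s = 1 then v else rot (- 1) v)"
    by (auto simp: spread_def rot_uminus rot_minus rot_rot)
  then show ?thesis by (simp add: spread_inject)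
qed

locale decimated_path = folding_path a P + decimated: folding_path "\<lambda>i. a (e + 2 * i)" P'
  for a P e P' +
  assumes base: "e \<in> E_seq 1 a" and vertices: "P (e + 2 * i) = P e + spread (P' i)"

lemma (in folding_path) decimated_path_ex:
  assumes level_e: "e \<in> E_seq 1 a"
  obtains P' where "decimated_path a P e P'"
proof -
  have even_level: "e + 2 * i \<in> E_seq (Suc 0) a" for i using E_seq_add[OF level_e, of i]
    by (simp add: mult.commute)
  have "\<exists>q. P (e + 2 * i) = P e + spread q" for i
  proof -
    have "P (e + 2 * i) - P e \<in> Lam (Suc 0)"
      using E_seq_iff_vertex[OF even_level[of 0], of "e + 2 * i"] even_level[of i] by simp
    then obtain q where "P (e + 2 * i) - P e = spread q" by (auto simp: Lam_Suc)
    then have "P (e + 2 * i) = P e + spread q" by (simp add: algebra_simps)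
    then show ?thesis by blast
  qed
  then obtain P' where P'_vertices: "\<And>i. P (e + 2 * i) = P e + spread (P' i)" by metis
  have spread_P': "spread (P' j - P' i) = P (e + 2 * j) - P (e + 2 * i)" for i j
    by (simp add: P'_vertices spread_diff)
  interpret decimated: paperfolding "\<lambda>i. a (e + 2 * i)"
    by (rule paperfolding_decimation[OF level_e])
  have "decimated_path a P e P'"
  proof
    fix i
    let ?v = "P (e + 2 * i + 1) - P (e + 2 * i)"
    have "spread (P' (i + 1) - P' i) = ?v + rot (a (e + 2 * i + 1)) ?v"
      unfolding spread_P' using coarse_step_split[of "e + 2 * i" 0] E_seq_0
      by (simp add: algebra_simps)
    then show "P' (i + 1) - P' i \<in> unit_vectors"
      unfolding spread_eq_add_rot_iff[OF sign] using step[of "e + 2 * i"]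
      by (simp add: rot_unit_vector)
    have "P (e + 2 * (i + 1)) - P (e + 2 * i) =
        rot (a (e + 2 * i)) (P (e + 2 * i) - P (e + 2 * (i - 1)))"
      using coarse_turn[OF even_level[of "i - 1"]] by (simp add: algebra_simps)
    then have "spread (P' (i + 1) - P' i) = spread (rot (a (e + 2 * i)) (P' i - P' (i - 1)))"
      unfolding spread_rot spread_P' .
    then show "P' (i + 1) - P' i = rot (a (e + 2 * i)) (P' i - P' (i - 1))"
      unfolding spread_inject .
  qed (use level_e P'_vertices in blast)+
  then show ?thesis by (rule that)
qed

context decimated_path
begin

definition parity :: bool where
  "parity \<longleftrightarrow> (P' 0 \<in> Lam (Suc 0)) = (a (e + 1) = - 1)"

lemma corner_sign: "a (e + 2 * i + 1) = (if even i then a (e + 1) else - a (e + 1))"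
  using alternates_at_after_E_seq_1[OF base] unfolding alternates_at_def
  by (simp add: algebra_simps)

lemma bend_sign_vertex: "bend_sign parity (P' i) = - a (e + 2 * i + 1)"
proof -
  have "P' i - P' 0 \<in> Lam (Suc 0) \<longleftrightarrow> even i"
    using decimated.coarse_vertices_Lam[of 0 0 i] decimated.E_seq_0 by simp
  then have "P' i \<in> Lam (Suc 0) \<longleftrightarrow> (even i \<longleftrightarrow> P' 0 \<in> Lam (Suc 0))" by (auto simp: Lam_1_iff)
  then show ?thesis using sign[of "e + 1"] by (auto simp: corner_sign bend_sign_def parity_def)
qed

lemma corner_eq_bend:
  "P (e + 2 * i + 1) = P e + spread (P' i) + bend parity (P' i) (P' (i + 1) - P' i)"
proof -
  let ?s = "a (e + 2 * i + 1)" and ?v = "P (e + 2 * i + 1) - P (e + 2 * i)"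
  have "P (e + 2 * (i + 1)) - P (e + 2 * i + 1) = rot ?s ?v"
    using turn[of "e + 2 * i + 1"] by (simp add: algebra_simps)
  then have "spread (P' (i + 1) - P' i) = ?v + rot ?s ?v"
    unfolding vertices by (simp add: spread_diff algebra_simps)
  then have "P' (i + 1) - P' i = (if ?s = 1 then ?v else rot (- 1) ?v)"
    unfolding spread_eq_add_rot_iff[OF sign] .
  then have "bend parity (P' i) (P' (i + 1) - P' i) = ?v"
    using sign[of "e + 2 * i + 1"]
    by (auto simp: bend_def bend_sign_vertex rot_uminus rot_minus rot_rot)
  then show ?thesis by (simp flip: vertices)
qed

lemma unfolds_path: "unfolds P' P (P e) parity"
  unfolding unfolds_def
proof (intro allI ballI impI)
  fix x d assume "traverses P' x (x + d)"
  then obtain i where "{P' i, P' (i + 1)} = {x, x + d}" unfolding traverses_def by blast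
  then consider "x = P' i" "x + d = P' (i + 1)" | "x = P' (i + 1)" "x + d = P' i"
    by (auto simp: doubleton_eq_iff)
  then show "traverses P (P e + spread x) (P e + spread x + bend parity x d)"
  proof cases
    case 1
    then have "P e + spread x + bend parity x d = P (e + 2 * i + 1)"
      unfolding corner_eq_bend by (simp flip: 1)
    then show ?thesis using traverses_step[of P "e + 2 * i"] by (simp add: 1 flip: vertices)
  next
    case 2
    let ?d = "P' (i + 1) - P' i"
    have d_eq: "d = - ?d" by (simp flip: 2)
    have "spread (P' (i + 1)) = spread (P' i) + bend parity (P' i) ?d + bend parity (P' (i + 1)) ?d"
      using spread_bend[OF decimated.step[of i], of parity "P' i"]
      by (simp add: spread_diff algebra_simps)
    then have "P e + spread x + bend parity x d = P (e + 2 * i + 1)"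
      unfolding corner_eq_bend 2(1) d_eq bend_minus by simp
    then show ?thesis using traverses_step[of P "e + 2 * i + 1"]
      by (simp add: 2(1) traverses_commute algebra_simps flip: vertices)
  qed
qed

text \<open>Three equal turns in a row make the coarser path run along two opposite sides of a square
  that bend towards its centre.\<close>

lemma exists_saturated_odd: "\<exists>z. saturated P z \<and> z - P e \<notin> Lam (Suc 0)"
proof -
  obtain j where equal_signs: "j \<in> E_seq 1 a" "a (j + 1) = a j" "a (j + 2) = a j"
    using exists_three_equal_signs by blast
  have "2 dvd j - e" using E_seq_iff[OF base] equal_signs(1) by simp
  then obtain k where "j - e = 2 * k" by (rule dvdE)
  then have j_eq: "j = e + 2 * k" by simp
  let ?x = "P' (k - 1)" and ?d = "P' k - P' (k - 1)"
  have unit_d: "?d \<in> unit_vectors" using decimated.step[of "k - 1"] by simp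
  have turns: "P' (k + 1) = P' k + rot (a j) ?d" "P' (k + 2) = P' (k + 1) - ?d"
    using decimated.turn[of k] decimated.turn[of "k + 1"] equal_signs(3) rot_rot[OF sign, of j ?d]
    by (simp_all add: j_eq algebra_simps)
  have bend: "a j = bend_sign parity ?x"
    using equal_signs(2) corner_sign[of k] corner_sign[of "k - 1"]
    by (auto simp: bend_sign_vertex j_eq split: if_splits)
  have "saturated P (P e + spread ?x + bend parity ?x ?d)"
  proof (rule unfolds_opposite_edges[OF unfolds_path unit_d])
    show "P' (k + 1) = ?x + ?d + rot (bend_sign parity ?x) ?d"
      unfolding bend[symmetric] turns by simp
    show "traverses P' ?x (?x + ?d)" using traverses_step[of P' "k - 1"] by simp
    show "traverses P' (P' (k + 1)) (P' (k + 1) - ?d)"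
      using traverses_step[of P' "k + 1"] unfolding turns(2)[symmetric] by (simp add: add.assoc)
  qed
  moreover have "spread ?x + bend parity ?x ?d \<notin> Lam (Suc 0)"
    using Lam_1_add_unit_vector[of "bend parity ?x ?d" "spread ?x"] unit_d spread_in_Lam[of ?x 0]
    by (simp add: bend_unit_vector Lam_0)
  ultimately show ?thesis
    by (intro exI[of _ "P e + spread ?x + bend parity ?x ?d"]) (simp add: algebra_simps)
qed

end

context folding_path
begin

lemma exists_unfolds:
  obtains a' P' q b where "folding_path a' P'" "unfolds P' P q b"
proof -
  obtain e where "e \<in> E_seq 1 a" using E_seq_ex_small .
  then obtain P' where "decimated_path a P e P'" by (rule decimated_path_ex)
  then interpret decimated_path a P e P' .
  show ?thesis using that decimated.folding_path_axioms unfolds_path .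
qed

lemma exists_saturated_parity: "\<exists>z. saturated P z \<and> (z \<in> Lam (Suc 0) \<longleftrightarrow> even_parity)"
proof -
  obtain e where "e \<in> E_seq 1 a" using E_seq_ex_small .
  then obtain P' where "decimated_path a P e P'" by (rule decimated_path_ex)
  then interpret decimated_path a P e P' .
  obtain z where odd_vertex: "saturated P z" "z - P e \<notin> Lam (Suc 0)"
    using exists_saturated_odd by blast
  obtain y where "saturated P' y"
    using decimated.E_seq_ex_small decimated.decimated_path_ex decimated_path.exists_saturated_odd
    by metis
  then have "saturated P (P e + spread y)" by (rule unfolds_saturated_even[OF unfolds_path])
  moreover have "P e + spread y \<in> Lam (Suc 0) \<longleftrightarrow> z \<notin> Lam (Suc 0)"
    using odd_vertex(2) by (auto simp: Lam_1_iff fst_spread snd_spread)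
  ultimately show ?thesis using odd_vertex(1) by (cases "(z \<in> Lam (Suc 0)) = even_parity") blast+
qed

end

theorem exists_diamond_saturated: "folding_path a P \<Longrightarrow> \<exists>p. diamond_saturated (2 ^ n) P p"
proof (induction n arbitrary: a P)
  case 0
  obtain a' P' q b where unfold: "folding_path a' P'" "unfolds P' P q b"
    using folding_path.exists_unfolds[OF 0] .
  obtain a'' P'' q' b' where unfold': "folding_path a'' P''" "unfolds P'' P' q' b'"
    using folding_path.exists_unfolds[OF unfold(1)] .
  obtain x where star: "saturated P'' x" "x \<in> Lam (Suc 0) \<longleftrightarrow> b' = ((q' \<in> Lam (Suc 0)) = b)"
    using folding_path.exists_saturated_parity[OF unfold'(1)] by blast
  have "q' + spread x \<in> Lam (Suc 0) \<longleftrightarrow> q' \<in> Lam (Suc 0)"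
    using spread_in_Lam[of x 0] by (intro Lam_add_iff) (simp add: Lam_0)
  then have "bend_sign b' x = bend_sign b (q' + spread x)"
    using star(2) by (auto simp: bend_sign_def)
  then have "diamond_saturated 1 P (q + spread (q' + spread x))"
    by (rule unfolds_twice_saturated[OF unfold'(2) unfold(2) star(1)])
  then show ?case unfolding power_0 by blast
next
  case (Suc n)
  obtain a' P' q b where unfold: "folding_path a' P'" "unfolds P' P q b"
    using folding_path.exists_unfolds[OF Suc.prems] .
  obtain a'' P'' q' b' where unfold': "folding_path a'' P''" "unfolds P'' P' q' b'"
    using folding_path.exists_unfolds[OF unfold(1)] .
  obtain p where "diamond_saturated (2 ^ n) P'' p" using Suc.IH[OF unfold'(1)] by blast
  then have "diamond_saturated (2 * 2 ^ n) P (q + spread (q' + spread p))"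
    by (intro unfolds_diamond_saturated[OF unfold(2)] unfolds_square_saturated[OF unfold'(2)])
  then show ?case unfolding power_Suc by blast
qed

subsection \<open>Curves and coverings\<close>

locale folding_curve =
  fixes C :: "int \<Rightarrow> segment"
  assumes folding: "complete_folding_curve C"
begin

lemma dir_unit_vector: "dir (C i) \<in> unit_vectors"
  and support_inject: "support (C i) = support (C j) \<longleftrightarrow> i = j"
  using folding unfolding complete_folding_curve_def complete_curve_def is_segment_iff by blast+

lemma fst_eq_snd: "fst (C i) = snd (C (i - 1))"
  using folding unfolding complete_folding_curve_def complete_curve_def by (metis diff_add_cancel)

lemma dir_eq_diff: "dir (C i) = snd (C i) - snd (C (i - 1))"
  by (simp add: dir_def fst_eq_snd)

lemma dir_turn: "dir (C (i + 1)) = rot (assoc_seq C i) (dir (C i))"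
proof -
  have "perpendicular (C i) (C (i + 1))"
    using folding unfolding complete_folding_curve_def complete_curve_def by blast
  then show ?thesis using dir_unit_vector[of i] dir_unit_vector[of "i + 1"]
    by (auto simp: unit_vectors_def perpendicular_def assoc_seq_def left_turn_def rot_def)
qed

end

sublocale folding_curve \<subseteq> folding_path "assoc_seq C" "\<lambda>i. snd (C i)"
proof -
  interpret paperfolding "assoc_seq C"
    using folding unfolding complete_folding_curve_def
    by (intro complete_folding_seq_imp_paperfolding) blast
  show "folding_path (assoc_seq C) (\<lambda>i. snd (C i))"
  proof
    show "snd (C (i + 1)) - snd (C i) \<in> unit_vectors" for i
      using dir_unit_vector[of "i + 1"] by (simp add: dir_eq_diff)
    show "snd (C (i + 1)) - snd (C i) = rot (assoc_seq C i) (snd (C i) - snd (C (i - 1)))" for i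
      using dir_turn[of i] by (simp add: dir_eq_diff)
  qed
qed

context folding_curve
begin

lemma horizontal_add: "horizontal (C (i + k)) \<longleftrightarrow> (horizontal (C i) \<longleftrightarrow> even k)"
proof -
  have turn: "horizontal (C (j + 1)) \<longleftrightarrow> \<not> horizontal (C j)" for j
    using dir_unit_vector[of j] dir_turn[of j] sign[of j]
    by (auto simp: horizontal_def unit_vectors_def rot_def)
  show ?thesis
  proof (induction k rule: int_induct[where k = 0])
    case (step1 k)
    then show ?case using turn[of "i + k"] by (simp add: add.assoc)
  next
    case (step2 k)
    then show ?case using turn[of "i + (k - 1)"] by (auto simp: add.assoc)
  qed simp
qed

lemma vertical_iff: "vertical (C i) \<longleftrightarrow> \<not> horizontal (C i)"
  using dir_unit_vector[of i] by (auto simp: horizontal_def vertical_def unit_vectors_def)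

lemma horizontal_E_seq_1:
  assumes "i \<in> E_seq 1 (assoc_seq C)"
  shows "horizontal (C j) \<longleftrightarrow> (horizontal (C i) \<longleftrightarrow> j \<in> E_seq 1 (assoc_seq C))"
  using horizontal_add[of i "j - i"] E_seq_iff[OF assms, of j] by simp

lemma type_V_iff: "type_V C \<longleftrightarrow> \<not> type_H C"
proof -
  obtain i where "i \<in> E_seq 1 (assoc_seq C)" using E_seq_ex_small .
  then show ?thesis unfolding type_H_def type_V_def vertical_iff using horizontal_E_seq_1 by blast
qed

lemma horizontal_iff: "horizontal (C j) \<longleftrightarrow> (type_H C \<longleftrightarrow> j \<in> E_seq 1 (assoc_seq C))"
proof -
  obtain i where "i \<in> E_seq 1 (assoc_seq C)" using E_seq_ex_small .
  then show ?thesis unfolding type_H_def using horizontal_E_seq_1 by blast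
qed

lemma E_curve_eq:
  assumes "j \<in> E_seq m (assoc_seq C)"
  shows "E_curve m C = {x. x - snd (C j) \<in> Lam m}"
proof -
  define i where "i = (SOME i. i \<in> E_seq m (assoc_seq C))"
  have "i \<in> E_seq m (assoc_seq C)" unfolding i_def using assms by (rule someI)
  then have i_cong_j: "snd (C i) - snd (C j) \<in> Lam m" using E_seq_iff_vertex[OF assms] by simp
  have "x = snd (C i) + l \<longleftrightarrow> x - snd (C i) = l" for x l by auto
  then have "E_curve m C = {x. x - snd (C i) \<in> Lam m}" unfolding E_curve_def i_def Let_def by simp
  also have "\<dots> = {x. x - snd (C j) \<in> Lam m}"
    using Lam_add_iff[OF i_cong_j, of "_ - snd (C i)"] by simp
  finally show ?thesis .
qed

lemma E_curve_iff: "snd (C i) \<in> E_curve m C \<longleftrightarrow> i \<in> E_seq m (assoc_seq C)"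
proof -
  obtain j where level_j: "j \<in> E_seq m (assoc_seq C)" using E_seq_ex_small .
  show ?thesis unfolding E_curve_eq[OF level_j] E_seq_iff_vertex[OF level_j] by simp
qed

lemma E_curve_cong:
  assumes "y - x \<in> Lam m"
  shows "y \<in> E_curve m C \<longleftrightarrow> x \<in> E_curve m C"
proof -
  obtain j where level_j: "j \<in> E_seq m (assoc_seq C)" using E_seq_ex_small .
  show ?thesis using Lam_add_iff[OF assms, of "x - snd (C j)"] unfolding E_curve_eq[OF level_j]
    by simp
qed

lemma E_curve_diff:
  assumes "x \<in> E_curve m C"
  shows "y \<in> E_curve m C \<longleftrightarrow> y - x \<in> Lam m"
proof -
  obtain j where level_j: "j \<in> E_seq m (assoc_seq C)" using E_seq_ex_small .
  show ?thesis using assms Lam_add_iff[of "x - snd (C j)" m "y - x"]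
    unfolding E_curve_eq[OF level_j]
    by simp
qed

end

definition decorate :: "(int \<Rightarrow> segment) \<Rightarrow> int \<Rightarrow> decorated" where
  "decorate C i = (C i, support (C (i - 1)), support (C (i + 1)))"

definition shift_segment :: "point \<Rightarrow> segment \<Rightarrow> segment" where
  "shift_segment v s = (v + fst s, v + snd s)"

lemma decorated_segments_eq: "decorated_segments \<C> = {decorate C i | C i. C \<in> \<C>}"
  by (simp add: decorated_segments_def decorate_def)

lemma fst_shift_segment: "fst (shift_segment v s) = v + fst s"
  and snd_shift_segment: "snd (shift_segment v s) = v + snd s"
  and dir_shift_segment: "dir (shift_segment v s) = dir s"
  and support_shift_segment: "support (shift_segment v s) = (+) v ` support s"
  by (simp_all add: shift_segment_def dir_def support_def)

lemma translate_eq: "translate v (s, e, f) = (shift_segment v s, (+) v ` e, (+) v ` f)"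
  by (cases s) (simp add: shift_segment_def)

lemma translate_decorate: "translate v (decorate C i) = (shift_segment v (C i),
    support (shift_segment v (C (i - 1))), support (shift_segment v (C (i + 1))))"
  unfolding decorate_def translate_eq support_shift_segment ..

lemma vertices_translate: "vertices (translate v d) = (+) v ` vertices d"
proof -
  obtain s e f where d_eq: "d = (s, e, f)" by (cases d) auto
  show ?thesis unfolding d_eq translate_eq vertices.simps support_shift_segment
    by (simp add: image_Un)
qed

locale curve_covering =
  fixes \<C> :: "(int \<Rightarrow> segment) set"
  assumes covering: "covering \<C>"
begin

lemma folding_curve: "C \<in> \<C> \<Longrightarrow> folding_curve C"
  using covering unfolding covering_def by (simp add: folding_curve_def)

lemma edge_covered:
  assumes "dir s \<in> unit_vectors"
  obtains C i where "C \<in> \<C>" "support (C i) = support s"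
    "\<And>D j. D \<in> \<C> \<Longrightarrow> support (D j) = support s \<Longrightarrow> same_curve C D"
proof -
  have "support s \<in> unit_edges" using assms unfolding unit_edges_def is_segment_iff by blast
  with covering obtain C where "C \<in> \<C>" "\<exists>!i. support (C i) = support s"
    "\<forall>D\<in>\<C>. (\<exists>i. support (D i) = support s) \<longrightarrow> same_curve C D"
    unfolding covering_def by meson
  then show ?thesis using that by (metis ex1_implies_ex)
qed

lemma shared_support:
  assumes "C \<in> \<C>" "D \<in> \<C>" "support (D j) = support (C i)"
  shows "D (j + k) = C (i + k)"
proof -
  interpret C: folding_curve C by (rule folding_curve[OF assms(1)])
  obtain B l where "\<And>D j. D \<in> \<C> \<Longrightarrow> support (D j) = support (C i) \<Longrightarrow> same_curve B D"
    using edge_covered[OF C.dir_unit_vector[of i]] by metis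
  then have "same_curve B C" "same_curve B D" using assms by blast+
  then obtain m n where shifts: "\<And>k. C k = B (k + m)" "\<And>k. D k = B (k + n)"
    unfolding same_curve_def by blast
  have D_eq: "D k = C (k + (n - m))" for k unfolding shifts by (simp add: algebra_simps)
  have "j + (n - m) = i" using assms(3) unfolding D_eq C.support_inject .
  then have "j + k + (n - m) = i + k" by simp
  then show ?thesis unfolding D_eq by (rule arg_cong)
qed

end

subsection \<open>Consequences of the local isomorphism property\<close>

definition compatible :: "(int \<Rightarrow> segment) \<Rightarrow> (int \<Rightarrow> segment) \<Rightarrow> bool" where
  "compatible C D \<longleftrightarrow> (type_H C \<longleftrightarrow> type_H D) \<and> (\<forall>k. E_curve k C = E_curve k D) \<and>
     subwords (assoc_seq C) = subwords (assoc_seq D)"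

definition translated_window :: "nat \<Rightarrow> point \<Rightarrow> (int \<Rightarrow> segment) \<Rightarrow> (int \<Rightarrow> segment) \<Rightarrow> int \<Rightarrow> bool" where
  "translated_window N v C D s \<longleftrightarrow> (\<forall>k. \<bar>k\<bar> \<le> int N \<longrightarrow> D (s + k) = shift_segment v (C k))"

lemma translated_window_assoc_seq:
  assumes "translated_window (Suc N) v C D s" "\<bar>k\<bar> \<le> int N"
  shows "assoc_seq D (s + k) = assoc_seq C k"
proof -
  have "D (s + k) = shift_segment v (C k)" "D (s + (k + 1)) = shift_segment v (C (k + 1))"
    using assms unfolding translated_window_def by auto
  then show ?thesis by (simp add: assoc_seq_def left_turn_def dir_shift_segment add.assoc)
qed

lemma translated_window_E_seq:
  assumes "folding_curve C" "folding_curve D"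
    and window: "translated_window (Suc (2 ^ (n + 4))) v C D s"
  shows "s + x \<in> E_seq n (assoc_seq D) \<longleftrightarrow> x \<in> E_seq n (assoc_seq C)"
proof -
  interpret C: folding_curve C by fact
  interpret D: folding_curve D by fact
  show ?thesis
    using translated_window_assoc_seq[OF window]
    by (intro E_seq_window[OF C.paperfolding_axioms D.paperfolding_axioms]) simp
qed

lemma translated_window_E_seq_ex:
  assumes "folding_curve C" "folding_curve D"
    and window: "translated_window (Suc (2 ^ (n + 4))) v C D s"
  obtains x where "x \<in> E_seq n (assoc_seq C)" "s + x \<in> E_seq n (assoc_seq D)"
    "D (s + x) = shift_segment v (C x)"
proof -
  interpret C: folding_curve C by fact
  obtain x where small: "x \<in> E_seq n (assoc_seq C)" "0 \<le> x" "x < 2 ^ n" by (rule C.E_seq_ex_small)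
  have "(2::int) ^ (n + 4) = 16 * 2 ^ n" by (simp add: power_add)
  then have "\<bar>x\<bar> \<le> int (Suc (2 ^ (n + 4)))" using small by simp
  then have "D (s + x) = shift_segment v (C x)"
    using window unfolding translated_window_def by blast
  then show ?thesis using that small(1) translated_window_E_seq[OF assms] by blast
qed

lemma translated_window_E_curve:
  assumes "folding_curve C" "folding_curve D"
    and window: "translated_window (Suc (2 ^ (n + 4))) v C D s"
  shows "v + y \<in> E_curve n D \<longleftrightarrow> y \<in> E_curve n C"
proof -
  obtain x where level_x: "x \<in> E_seq n (assoc_seq C)" "s + x \<in> E_seq n (assoc_seq D)"
    "D (s + x) = shift_segment v (C x)" by (rule translated_window_E_seq_ex[OF assms])
  from folding_curve.E_curve_eq[OF assms(1) level_x(1)]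
    folding_curve.E_curve_eq[OF assms(2) level_x(2)]
  show ?thesis by (simp add: level_x(3) snd_shift_segment)
qed

lemma translated_window_type_H:
  assumes "folding_curve C" "folding_curve D"
    and window: "translated_window (Suc (2 ^ (1 + 4))) v C D s"
  shows "type_H C \<longleftrightarrow> type_H D"
proof -
  obtain x where level_x: "x \<in> E_seq 1 (assoc_seq C)" "s + x \<in> E_seq 1 (assoc_seq D)"
    "D (s + x) = shift_segment v (C x)" by (rule translated_window_E_seq_ex[OF assms])
  have "horizontal (D (s + x)) \<longleftrightarrow> horizontal (C x)"
    by (simp add: level_x(3) horizontal_def dir_shift_segment)
  then show ?thesis
    using level_x(1,2) folding_curve.horizontal_iff[OF assms(1)]
      folding_curve.horizontal_iff[OF assms(2)]
    by blast
qed

lemma translated_windows_imp_compatible: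
  assumes "folding_curve C" "folding_curve D"
    and common_windows: "\<And>N. \<exists>v s t. translated_window N v C D s \<and> translated_window N v D D t"
    and reverse_windows: "\<And>N. \<exists>v s. translated_window N v D C s"
  shows "compatible C D"
proof -
  have "E_curve n C = E_curve n D" for n
  proof -
    obtain v s t where "translated_window (Suc (2 ^ (n + 4))) v C D s"
      "translated_window (Suc (2 ^ (n + 4))) v D D t" using common_windows by blast
    then have "y \<in> E_curve n C \<longleftrightarrow> y \<in> E_curve n D" for y
      using translated_window_E_curve[OF assms(1,2)] translated_window_E_curve[OF assms(2,2)]
      by metis
    then show ?thesis by blast
  qed
  moreover have "subwords (assoc_seq A) \<subseteq> subwords (assoc_seq B)"
    if "\<And>N. \<exists>v s. translated_window N v A B s" for A B
    unfolding subwords_subset_iff using that translated_window_assoc_seq by metis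
  moreover have "type_H C \<longleftrightarrow> type_H D"
    using common_windows translated_window_type_H[OF assms(1,2)] by blast
  ultimately show ?thesis unfolding compatible_def using common_windows reverse_windows by blast
qed

lemma taxicab_le_if_in_cball:
  assumes "real_point q \<in> cball (real_point p) r" "2 * r \<le> of_int k"
  shows "\<bar>fst (q - p)\<bar> + \<bar>snd (q - p)\<bar> \<le> k"
proof -
  let ?p = "real_point p" and ?q = "real_point q"
  have "dist (fst ?p) (fst ?q) \<le> r" "dist (snd ?p) (snd ?q) \<le> r"
    using assms(1) dist_fst_le[of ?p ?q] dist_snd_le[of ?p ?q] by simp_all
  then have "real_of_int (\<bar>fst (q - p)\<bar> + \<bar>snd (q - p)\<bar>) \<le> of_int k"
    using assms(2) by (simp add: real_point_def dist_real_def abs_minus_commute)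
  then show ?thesis by (simp only: of_int_le_iff)
qed

lemma (in folding_curve) translated_window_if_decorated:
  assumes copies: "\<And>k. \<bar>k\<bar> \<le> int N \<Longrightarrow> \<exists>j. decorate C j = translate v (decorate B k)"
  obtains s where "translated_window N v B C s"
proof -
  obtain f where index_map: "\<And>k. \<bar>k\<bar> \<le> int N \<Longrightarrow> decorate C (f k) = translate v (decorate B k)"
    using copies by metis
  have copied: "C (f k) = shift_segment v (B k)"
    "support (C (f k + 1)) = support (shift_segment v (B (k + 1)))" if "\<bar>k\<bar> \<le> int N" for k
    using index_map[OF that] unfolding translate_decorate decorate_def[of C] by simp_all
  have step: "f (k + 1) = f k + 1" if "\<bar>k\<bar> \<le> int N" "\<bar>k + 1\<bar> \<le> int N" for k
    using copied(1)[OF that(2)] copied(2)[OF that(1)] support_inject by metis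
  have "f k = f 0 + k" if "\<bar>k\<bar> \<le> int N" for k
    using that
  proof (induction k rule: int_induct[where k = 0])
    case (step1 k)
    then show ?case using step[of k] by simp
  next
    case (step2 k)
    then show ?case using step[of "k - 1"] by simp
  qed simp
  then have "translated_window N v B C (f 0)"
    unfolding translated_window_def using copied(1) by metis
  then show ?thesis by (rule that)
qed

context curve_covering
begin

lemma decorated_segment_at_saturated:
  assumes in_covering: "D \<in> \<C>" and decorated: "d \<in> decorated_segments \<C>"
    and sat: "saturated (\<lambda>i. snd (D i)) (fst (fst d))"
  shows "\<exists>j. decorate D j = d"
proof -
  obtain B i where B_segment: "B \<in> \<C>" "d = decorate B i"
    using decorated unfolding decorated_segments_eq by auto
  interpret B: folding_curve B by (rule folding_curve[OF B_segment(1)])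
  interpret D: folding_curve D by (rule folding_curve[OF in_covering])
  have "traverses (\<lambda>i. snd (D i)) (fst (B i)) (fst (B i) + dir (B i))"
    using sat B.dir_unit_vector unfolding saturated_def B_segment(2) decorate_def by simp
  then obtain j where "{snd (D j), snd (D (j + 1))} = {fst (B i), snd (B i)}"
    unfolding traverses_def dir_def by auto
  then have "support (D (j + 1)) = support (B i)"
    using D.fst_eq_snd[of "j + 1"] by (simp add: support_def)
  from shared_support[OF B_segment(1) in_covering this] have "D (j + 1 + k) = B (i + k)" for k .
  from this[of "- 1"] this[of 0] this[of 1] have "decorate D (j + 1) = d"
    unfolding B_segment(2) decorate_def by (simp add: algebra_simps)
  then show ?thesis ..
qed

text \<open>A large disk all of whose edges belong to \<open>D\<close> contains translates of long pieces of \<open>C\<close>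
  and \<open>D\<close> by the same vector, and both translates must then be pieces of \<open>D\<close>.\<close>

lemma common_translation:
  assumes lip: "local_isomorphism_property \<C>" and curves: "C \<in> \<C>" "D \<in> \<C>"
  shows "\<exists>v s t. translated_window N v C D s \<and> translated_window N v D D t"
proof -
  interpret D: folding_curve D by (rule folding_curve[OF curves(2)])
  define F where "F = (\<Union>B\<in>{C, D}. decorate B ` {- int N..int N})"
  have "finite F \<and> F \<subseteq> decorated_segments \<C>"
    unfolding F_def decorated_segments_eq using curves by blast
  from lip[unfolded local_isomorphism_property_def, rule_format, OF this]
  obtain r where radius: "\<And>z. \<exists>v. translate v ` F \<subseteq> decorated_segments \<C> \<and>
      (\<forall>d\<in>translate v ` F. real_point ` vertices d \<subseteq> cball z r)" by blast
  obtain n where n_large: "2 * r < 2 ^ n" using real_arch_pow[of 2 "2 * r"] by auto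
  obtain p where saturated_disk: "diamond_saturated (2 ^ n) (\<lambda>i. snd (D i)) p"
    using exists_diamond_saturated[OF D.folding_path_axioms] by blast
  obtain v where translation: "translate v ` F \<subseteq> decorated_segments \<C>"
    "\<forall>d\<in>translate v ` F. real_point ` vertices d \<subseteq> cball (real_point p) r"
    using radius[of "real_point p"] by (elim exE conjE)
  have "\<exists>s. translated_window N v B D s" if B_cases: "B \<in> {C, D}" for B
  proof -
    have "\<exists>j. decorate D j = translate v (decorate B k)" if "\<bar>k\<bar> \<le> int N" for k
    proof -
      let ?d = "translate v (decorate B k)"
      have "decorate B k \<in> F" using B_cases that unfolding F_def by (auto simp: abs_le_iff)
      then have translated: "?d \<in> translate v ` F" by blast
      have "fst (fst ?d) \<in> vertices ?d" by (simp add: translate_decorate support_def)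
      then have "real_point (fst (fst ?d)) \<in> cball (real_point p) r"
        using translation(2) translated by blast
      then have "\<bar>fst (fst (fst ?d) - p)\<bar> + \<bar>snd (fst (fst ?d) - p)\<bar> \<le> 2 ^ n"
        by (rule taxicab_le_if_in_cball) (use n_large in simp)
      then have "saturated (\<lambda>i. snd (D i)) (p + (fst (fst ?d) - p))"
        using saturated_disk unfolding diamond_saturated_def by blast
      then have "saturated (\<lambda>i. snd (D i)) (fst (fst ?d))" by simp
      then show ?thesis using translation(1) translated
        by (intro decorated_segment_at_saturated[OF curves(2)]) blast+
    qed
    then show ?thesis using D.translated_window_if_decorated by metis
  qed
  then show ?thesis by blast
qed

lemma local_isomorphism_property_imp_compatible:
  assumes "local_isomorphism_property \<C>" "C \<in> \<C>" "D \<in> \<C>"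
  shows "compatible C D"
  using common_translation[OF assms(1)] assms(2,3) folding_curve
  by (intro translated_windows_imp_compatible) blast+

end

subsection \<open>Compatible curves\<close>

lemma Lam_double: "p + p \<in> Lam (Suc (Suc n)) \<longleftrightarrow> p \<in> Lam n"
proof -
  have double: "p + p = (p + rot 1 p) + rot (- 1) (p + rot 1 p)"
    by (simp add: rot_add rot_uminus rot_rot)
  show ?thesis
    unfolding double using Lam_turn[of "- 1" "p + rot 1 p" "Suc n"] Lam_turn[of 1 p n] by simp
qed

lemma dir_parallel_if_same_axis:
  assumes "dir s \<in> unit_vectors" "dir t \<in> unit_vectors" "horizontal s \<longleftrightarrow> horizontal t"
  shows "dir t = dir s \<or> dir t = - dir s"
  using assms by (auto simp: unit_vectors_def horizontal_def)

locale compatible_curves = C: folding_curve C + D: folding_curve D for C D +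
  assumes compatible: "compatible C D"
begin

lemma level_cong:
  assumes "snd (D j) - snd (C i) \<in> Lam n"
  shows "j \<in> E_seq n (assoc_seq D) \<longleftrightarrow> i \<in> E_seq n (assoc_seq C)"
proof -
  have "E_curve n C = E_curve n D" using compatible unfolding compatible_def by blast
  then show ?thesis using C.E_curve_cong[OF assms] C.E_curve_iff D.E_curve_iff by blast
qed

lemma horizontal_cong:
  "(horizontal (D j) \<longleftrightarrow> horizontal (C i)) \<longleftrightarrow> (j \<in> E_seq 1 (assoc_seq D) \<longleftrightarrow> i \<in> E_seq 1 (assoc_seq C))"
  using compatible C.horizontal_iff[of i] D.horizontal_iff[of j] unfolding compatible_def by blast

lemma sign_cong:
  assumes "i \<in> E_seq (Suc (Suc m)) (assoc_seq C)" "j \<in> E_seq (Suc (Suc m)) (assoc_seq D)"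
  shows "assoc_seq D (j + 2 ^ m) = assoc_seq C (i + 2 ^ m)"
  using compatible assms unfolding compatible_def
  by (intro subwords_subset_imp_sign_eq[OF C.paperfolding_axioms D.paperfolding_axioms]) auto

lemma coarse_step_cong:
  "i \<in> E_seq (Suc m) (assoc_seq C) \<Longrightarrow> j \<in> E_seq (Suc m) (assoc_seq D) \<Longrightarrow>
    (snd (D (j + 2 ^ m)) - snd (D j)) - (snd (C (i + 2 ^ m)) - snd (C i)) \<in> Lam (Suc (Suc m))"
proof (induction m arbitrary: i j)
  case 0
  then have "horizontal (C i) \<longleftrightarrow> horizontal (D j)" using horizontal_cong[of j i] by simp
  then have "horizontal (C (i + 1)) \<longleftrightarrow> horizontal (D (j + 1))"
    using C.horizontal_add[of i 1] D.horizontal_add[of j 1] by simp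
  then have "dir (D (j + 1)) = dir (C (i + 1)) \<or> dir (D (j + 1)) = - dir (C (i + 1))"
    by (intro dir_parallel_if_same_axis C.dir_unit_vector D.dir_unit_vector)
  then have "dir (D (j + 1)) - dir (C (i + 1)) = 0 \<or>
      dir (D (j + 1)) - dir (C (i + 1)) = - dir (C (i + 1)) + - dir (C (i + 1))" by auto
  then have "dir (D (j + 1)) - dir (C (i + 1)) \<in> Lam (Suc (Suc 0))"
    using Lam_double[of "- dir (C (i + 1))" 0] Lam_zero by (auto simp: Lam_0)
  then show ?case by (simp add: C.dir_eq_diff D.dir_eq_diff)
next
  case (Suc m)
  have lower_levels: "i \<in> E_seq (Suc m) (assoc_seq C)" "j \<in> E_seq (Suc m) (assoc_seq D)"
    using Suc.prems C.E_seq_SucD D.E_seq_SucD by blast+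
  let ?u = "snd (C (i + 2 ^ m)) - snd (C i)" and ?w = "snd (D (j + 2 ^ m)) - snd (D j)"
    and ?s = "assoc_seq C (i + 2 ^ m)"
  have split: "snd (D (j + 2 ^ Suc m)) - snd (D j) - (snd (C (i + 2 ^ Suc m)) - snd (C i)) =
      (?w - ?u) + rot ?s (?w - ?u)"
    unfolding C.coarse_step_split[OF C.E_seq_SucD[OF lower_levels(1)]]
      D.coarse_step_split[OF D.E_seq_SucD[OF lower_levels(2)]] sign_cong[OF Suc.prems]
    by (simp add: rot_diff)
  show ?case unfolding split Lam_turn[OF C.sign] by (rule Suc.IH[OF lower_levels])
qed

text \<open>At a vertex of level \<open>m\<close> the turn is decided by whether the vertex that comes \<open>2 ^ m\<close> steps
  earlier has level above \<open>m + 1\<close>.\<close>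

lemma turn_cong:
  assumes level_i: "i \<notin> E_seq n (assoc_seq C)" and cong: "snd (D j) - snd (C i) \<in> Lam (Suc n)"
  shows "assoc_seq D j = assoc_seq C i"
proof -
  obtain m where exact_i: "m < n" "i \<in> E_seq m (assoc_seq C)" "i \<notin> E_seq (Suc m) (assoc_seq C)"
    using C.exact_level[OF level_i] .
  have cong_le: "snd (D j) - snd (C i) \<in> Lam k" if "k \<le> Suc n" for k
    using cong Lam_antimono[OF that]
    by blast
  have exact_j: "j \<in> E_seq m (assoc_seq D)" "j \<notin> E_seq (Suc m) (assoc_seq D)"
    using level_cong[OF cong_le] exact_i by auto
  let ?i = "i - 2 ^ m" and ?j = "j - 2 ^ m"
  have previous: "?i \<in> E_seq (Suc m) (assoc_seq C)" "?j \<in> E_seq (Suc m) (assoc_seq D)"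
    using C.E_seq_half(2) D.E_seq_half(2) exact_i(2,3) exact_j by blast+
  have "snd (D j) - snd (C i) \<in> Lam (Suc (Suc m))" using exact_i(1) by (intro cong_le) simp
  from Lam_diff[OF this coarse_step_cong[OF previous]]
  have "snd (D ?j) - snd (C ?i) \<in> Lam (Suc (Suc m))" by (simp add: algebra_simps)
  note same_level = level_cong[OF this]
  show ?thesis
  proof (cases "?i \<in> E_seq (Suc (Suc m)) (assoc_seq C)")
    case True
    then show ?thesis using same_level sign_cong[of ?i m ?j] by simp
  next
    case False
    then have "?i + 2 ^ Suc m \<in> E_seq (Suc (Suc m)) (assoc_seq C)"
      "?j + 2 ^ Suc m \<in> E_seq (Suc (Suc m)) (assoc_seq D)"
      using C.E_seq_half(1)[OF previous(1)] D.E_seq_half(1)[OF previous(2)] same_level by blast+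
    then have upper: "i + 2 ^ m \<in> E_seq (Suc (Suc m)) (assoc_seq C)"
      "j + 2 ^ m \<in> E_seq (Suc (Suc m)) (assoc_seq D)"
      by (simp_all add: add.commute)
    show ?thesis
      using sign_cong[OF upper] C.E_seq_sign(1)[OF upper(1)] D.E_seq_sign(1)[OF upper(2)] by simp
  qed
qed

lemma orientation_cong:
  assumes even_v: "v \<in> Lam (Suc 0)" and support: "support (D j) = support (shift_segment v (C i))"
  shows "D j = shift_segment v (C i)"
proof (rule ccontr)
  assume "D j \<noteq> shift_segment v (C i)"
  then have reversed: "fst (D j) = v + snd (C i)" "snd (D j) = v + fst (C i)"
    using support by (auto simp: support_def doubleton_eq_iff prod_eq_iff shift_segment_def)
  then have "horizontal (D j) \<longleftrightarrow> horizontal (C i)" by (auto simp: horizontal_def dir_def)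
  then have "j \<in> E_seq 1 (assoc_seq D) \<longleftrightarrow> i \<in> E_seq 1 (assoc_seq C)" unfolding horizontal_cong .
  moreover have "snd (D j) - snd (C (i - 1)) \<in> Lam 1"
    using even_v by (simp add: reversed C.fst_eq_snd)
  then have "j \<in> E_seq 1 (assoc_seq D) \<longleftrightarrow> i - 1 \<in> E_seq 1 (assoc_seq C)" by (rule level_cong)
  moreover have "i - 1 \<in> E_seq 1 (assoc_seq C) \<longleftrightarrow> i \<notin> E_seq 1 (assoc_seq C)"
    using C.E_seq_half(2)[of i 0] C.E_seq_0 by simp
  ultimately show False by blast
qed

end

subsection \<open>Compatible coverings\<close>

locale compatible_covering = curve_covering +
  assumes compatible: "C \<in> \<C> \<Longrightarrow> D \<in> \<C> \<Longrightarrow> compatible C D"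
begin

lemma compatible_curves: "C \<in> \<C> \<Longrightarrow> D \<in> \<C> \<Longrightarrow> compatible_curves C D"
  by (simp add: compatible_curves_def compatible_curves_axioms_def folding_curve compatible)

lemma same_vertex_same_turn:
  assumes curves: "C \<in> \<C>" "D \<in> \<C>" and vertex: "snd (D j) = snd (C i)"
  shows "assoc_seq D j = assoc_seq C i"
proof -
  interpret compatible_curves C D by (rule compatible_curves[OF curves])
  have same_segment: ?thesis if "D (j + k) = C (i + k)" for k
  proof -
    have "support (D (j + k)) = support (C (i + k))" using that by simp
    from shared_support[OF curves this, of "- k"] shared_support[OF curves this, of "1 - k"]
    show ?thesis by (simp add: assoc_seq_def)
  qed
  have "j \<in> E_seq 1 (assoc_seq D) \<longleftrightarrow> i \<in> E_seq 1 (assoc_seq C)"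
    by (rule level_cong) (simp add: vertex Lam_zero)
  then have "horizontal (C i) \<longleftrightarrow> horizontal (D j)" using horizontal_cong by blast
  then have "dir (D j) = dir (C i) \<or> dir (D j) = - dir (C i)"
    by (intro dir_parallel_if_same_axis C.dir_unit_vector D.dir_unit_vector)
  then show ?thesis
  proof
    assume "dir (D j) = dir (C i)"
    then have "D (j + 0) = C (i + 0)" using vertex by (auto simp: dir_def prod_eq_iff)
    then show ?thesis by (rule same_segment)
  next
    assume opposite: "dir (D j) = - dir (C i)"
    show ?thesis
    proof (rule ccontr)
      assume "assoc_seq D j \<noteq> assoc_seq C i"
      then have "assoc_seq D j = - assoc_seq C i" using C.sign[of i] D.sign[of j] by auto
      then have "dir (D (j + 1)) = dir (C (i + 1))"
        unfolding C.dir_turn D.dir_turn opposite by (simp add: rot_minus rot_uminus)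
      moreover have "fst (D (j + 1)) = fst (C (i + 1))"
        using vertex by (simp add: C.fst_eq_snd D.fst_eq_snd)
      ultimately have "D (j + 1) = C (i + 1)" by (auto simp: dir_def prod_eq_iff)
      then show False using same_segment \<open>assoc_seq D j \<noteq> assoc_seq C i\<close> by blast
    qed
  qed
qed

lemma vertex_ex:
  obtains C i where "C \<in> \<C>" "snd (C i) = x"
proof -
  have "dir (x, x + (1, 0)) \<in> unit_vectors" by (simp add: dir_def unit_vectors_def)
  then obtain C i where C_edge: "C \<in> \<C>" "support (C i) = support (x, x + (1, 0))"
    using edge_covered by metis
  then interpret folding_curve C by (intro folding_curve)
  have "x = snd (C i) \<or> x = snd (C (i - 1))"
    using C_edge(2) fst_eq_snd by (auto simp: support_def doubleton_eq_iff)
  then show ?thesis using C_edge(1) that by blast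
qed

definition turn_at :: "point \<Rightarrow> int" where
  "turn_at x = (SOME s. \<exists>C\<in>\<C>. \<exists>i. snd (C i) = x \<and> assoc_seq C i = s)"

lemma turn_at_vertex:
  assumes "C \<in> \<C>"
  shows "turn_at (snd (C i)) = assoc_seq C i"
proof -
  have "\<exists>B\<in>\<C>. \<exists>k. snd (B k) = snd (C i) \<and> assoc_seq B k = turn_at (snd (C i))"
    unfolding turn_at_def by (rule someI[of _ "assoc_seq C i"]) (use assms in blast)
  then show ?thesis using same_vertex_same_turn assms by metis
qed

definition level_set :: "nat \<Rightarrow> point set" where
  "level_set n = (\<Union>C\<in>\<C>. E_curve n C)"

lemma level_set_eq: "C \<in> \<C> \<Longrightarrow> level_set n = E_curve n C"
  using compatible unfolding level_set_def compatible_def by blast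

lemma level_set_vertex_iff: "C \<in> \<C> \<Longrightarrow> snd (C i) \<in> level_set n \<longleftrightarrow> i \<in> E_seq n (assoc_seq C)"
  using folding_curve.E_curve_iff[OF folding_curve] level_set_eq by simp

lemma level_set_diff: "x \<in> level_set n \<Longrightarrow> y \<in> level_set n \<longleftrightarrow> y - x \<in> Lam n"
  using folding_curve.E_curve_diff[OF folding_curve] vertex_ex level_set_eq by metis

lemma level_set_antimono:
  assumes "m \<le> n"
  shows "level_set n \<subseteq> level_set m"
proof
  fix x assume level_x: "x \<in> level_set n"
  obtain C i where C_vertex: "C \<in> \<C>" "snd (C i) = x" by (rule vertex_ex)
  interpret folding_curve C by (rule folding_curve[OF C_vertex(1)])
  show "x \<in> level_set m"
    using level_x E_seq_antimono[OF assms]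
      unfolding C_vertex(2)[symmetric] level_set_vertex_iff[OF C_vertex(1)]
    by blast
qed

lemma turn_at_cong:
  assumes "x \<notin> level_set n" "y - x \<in> Lam (Suc n)"
  shows "turn_at y = turn_at x"
proof -
  obtain C i where C_vertex: "C \<in> \<C>" "snd (C i) = x" by (rule vertex_ex)
  obtain D j where D_vertex: "D \<in> \<C>" "snd (D j) = y" by (rule vertex_ex)
  have "assoc_seq D j = assoc_seq C i"
    using compatible_curves.turn_cong[OF compatible_curves[OF C_vertex(1) D_vertex(1)]]
      level_set_vertex_iff[OF C_vertex(1)] assms C_vertex(2) D_vertex(2) by blast
  then show ?thesis
    using turn_at_vertex[OF C_vertex(1), of i] turn_at_vertex[OF D_vertex(1), of j]
      C_vertex(2) D_vertex(2) by simp
qed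

lemma infinite_level_unique:
  assumes "\<And>n. x \<in> level_set n" "\<And>n. y \<in> level_set n"
  shows "y = x"
proof -
  have "y - x \<in> Lam n" for n using level_set_diff[OF assms(1)] assms(2) by blast
  then have "y - x = 0" by (rule eq_zero_if_in_all_Lam)
  then show ?thesis by simp
qed

lemma infinite_level_twin:
  assumes infinite_level: "\<And>n. x \<in> level_set n"
  obtains y where "y - x \<in> Lam n" "y \<notin> level_set (Suc n)" "turn_at y = turn_at x"
proof -
  obtain C i where C_vertex: "C \<in> \<C>" "snd (C i) = x" by (rule vertex_ex)
  interpret folding_curve C by (rule folding_curve[OF C_vertex(1)])
  have infinite_index: "i \<in> E_seq k (assoc_seq C)" for k
    using infinite_level level_set_vertex_iff[OF C_vertex(1)] C_vertex(2) by blast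
  have "assoc_seq C (i - 2 ^ n) = - assoc_seq C (i + 2 ^ n)"
    by (rule E_seq_sign(1)[OF infinite_index])
  then have "assoc_seq C (i + 2 ^ n) = assoc_seq C i \<or> assoc_seq C (i - 2 ^ n) = assoc_seq C i"
    using sign[of i] sign[of "i + 2 ^ n"] by auto
  moreover have "i + 2 ^ n \<in> E_seq n (assoc_seq C)" "i - 2 ^ n \<in> E_seq n (assoc_seq C)"
    using E_seq_add[OF infinite_index, of 1 n] E_seq_add[OF infinite_index, of "- 1" n] by simp_all
  moreover have "i + 2 ^ n \<notin> E_seq (Suc n) (assoc_seq C)" "i - 2 ^ n \<notin> E_seq (Suc n) (assoc_seq C)"
    using E_seq_half[OF infinite_index] infinite_index by blast+
  ultimately obtain j where same_turn: "assoc_seq C j = assoc_seq C i" "j \<in> E_seq n (assoc_seq C)"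
    "j \<notin> E_seq (Suc n) (assoc_seq C)" by blast
  then show ?thesis
    using that[of "snd (C j)"] level_set_diff[OF infinite_level]
      level_set_vertex_iff[OF C_vertex(1)]
      turn_at_vertex[OF C_vertex(1), of i] turn_at_vertex[OF C_vertex(1), of j] C_vertex(2) by simp
qed

lemma infinite_level_periodic:
  obtains v where "v \<in> Lam n" "\<And>x l. (\<And>k. x \<in> level_set k) \<Longrightarrow> l \<in> Lam (Suc (Suc n)) \<Longrightarrow>
    turn_at (v + l + x) = turn_at x"
proof (cases "\<exists>x. \<forall>k. x \<in> level_set k")
  case True
  then obtain x where infinite_x: "\<And>k. x \<in> level_set k" by blast
  obtain y where twin: "y - x \<in> Lam n" "y \<notin> level_set (Suc n)" "turn_at y = turn_at x"
    using infinite_level_twin[OF infinite_x] .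
  show ?thesis
  proof (rule that[OF twin(1)])
    fix z l assume infinite_z: "\<And>k. z \<in> level_set k" and period: "l \<in> Lam (Suc (Suc n))"
    have "z = x" by (rule infinite_level_unique[OF infinite_x infinite_z])
    then have "turn_at (y - x + l + z) = turn_at y"
      using period by (intro turn_at_cong[OF twin(2)]) simp
    then show "turn_at (y - x + l + z) = turn_at z" using twin(3) \<open>z = x\<close> by simp
  qed
next
  case False
  then show ?thesis using that[OF Lam_zero] by blast
qed

lemma uniform_level:
  assumes "finite X"
  obtains n where "\<And>x k. x \<in> X \<Longrightarrow> x \<in> level_set n \<Longrightarrow> x \<in> level_set k"
proof -
  have "eventually (\<lambda>n. \<forall>x\<in>X. x \<in> level_set n \<longrightarrow> (\<forall>k. x \<in> level_set k)) sequentially"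
  proof (rule eventually_ball_finite[OF assms], intro ballI)
    show "eventually (\<lambda>n. x \<in> level_set n \<longrightarrow> (\<forall>k. x \<in> level_set k)) sequentially" for x
      unfolding eventually_sequentially using level_set_antimono by blast
  qed
  then show ?thesis using that unfolding eventually_sequentially by blast
qed

lemma periodic_turns:
  assumes "finite X"
  obtains v N where "\<And>l. l \<in> Lam N \<Longrightarrow> v + l \<in> Lam (Suc 0)"
    "\<And>l x. l \<in> Lam N \<Longrightarrow> x \<in> X \<Longrightarrow> turn_at (v + l + x) = turn_at x"
proof -
  obtain n where uniform: "\<And>x k. x \<in> X \<Longrightarrow> x \<in> level_set n \<Longrightarrow> x \<in> level_set k"
    using uniform_level[OF assms] by metis
  obtain v where translation: "v \<in> Lam (Suc n)" "\<And>x l. (\<And>k. x \<in> level_set k) \<Longrightarrow>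
      l \<in> Lam (Suc (Suc (Suc n))) \<Longrightarrow> turn_at (v + l + x) = turn_at x"
    using infinite_level_periodic[of "Suc n"] by metis
  have v_add: "v + l \<in> Lam (Suc n)" if "l \<in> Lam (Suc (Suc (Suc n)))" for l
    using translation(1) that Lam_SucD Lam_add by blast
  show ?thesis
  proof (rule that)
    fix l assume period: "l \<in> Lam (Suc (Suc (Suc n)))"
    have "Lam (Suc n) \<subseteq> Lam (Suc 0)" by (rule Lam_antimono) simp
    then show "v + l \<in> Lam (Suc 0)" using v_add[OF period] by blast
    fix x assume "x \<in> X"
    show "turn_at (v + l + x) = turn_at x"
    proof (cases "x \<in> level_set n")
      case True
      then show ?thesis using uniform[OF \<open>x \<in> X\<close>] period by (intro translation(2)) blast+
    next
      case False
      then show ?thesis using v_add[OF period] by (intro turn_at_cong) simp_all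
    qed
  qed
qed

lemma translate_decorated_segment:
  assumes decorated: "d \<in> decorated_segments \<C>" and even_v: "v \<in> Lam (Suc 0)"
    and turns: "\<And>x. x \<in> support (fst d) \<Longrightarrow> turn_at (v + x) = turn_at x"
  shows "translate v d \<in> decorated_segments \<C>"
proof -
  obtain C i where C_segment: "C \<in> \<C>" "d = decorate C i"
    using decorated unfolding decorated_segments_eq by blast
  interpret C: folding_curve C by (rule folding_curve[OF C_segment(1)])
  obtain D j where D_segment: "D \<in> \<C>" "support (D j) = support (shift_segment v (C i))"
    using edge_covered C.dir_unit_vector dir_shift_segment by metis
  interpret compatible_curves C D by (rule compatible_curves[OF C_segment(1) D_segment(1)])
  have current: "D j = shift_segment v (C i)" by (rule orientation_cong[OF even_v D_segment(2)])
  have same_turn: "assoc_seq D l = assoc_seq C k"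
    if "snd (D l) = v + snd (C k)" "snd (C k) \<in> support (C i)" for k l
    using turns[of "snd (C k)"] that turn_at_vertex[OF C_segment(1), of k]
      turn_at_vertex[OF D_segment(1), of l]
    by (simp add: C_segment(2) decorate_def)
  have "assoc_seq D j = assoc_seq C i"
    using current by (intro same_turn) (simp_all add: snd_shift_segment support_def)
  then have "dir (D (j + 1)) = dir (C (i + 1))"
    unfolding C.dir_turn D.dir_turn by (simp add: current dir_shift_segment)
  moreover have "fst (D (j + 1)) = v + fst (C (i + 1))"
    by (simp add: C.fst_eq_snd D.fst_eq_snd current snd_shift_segment)
  ultimately have following: "D (j + 1) = shift_segment v (C (i + 1))"
    by (auto simp: dir_def shift_segment_def prod_eq_iff)
  have vertex: "snd (D (j - 1)) = v + snd (C (i - 1))"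
    using current by (simp add: fst_shift_segment flip: C.fst_eq_snd D.fst_eq_snd)
  then have "assoc_seq D (j - 1) = assoc_seq C (i - 1)"
    by (rule same_turn) (simp add: support_def C.fst_eq_snd)
  then have "rot (assoc_seq C (i - 1)) (dir (D (j - 1))) =
      rot (assoc_seq C (i - 1)) (dir (C (i - 1)))"
    using C.dir_turn[of "i - 1"] D.dir_turn[of "j - 1"] current by (simp add: dir_shift_segment)
  then have "dir (D (j - 1)) = dir (C (i - 1))"
    using rot_rot[OF C.sign] by (metis neg_equal_iff_equal)
  then have previous: "D (j - 1) = shift_segment v (C (i - 1))"
    using vertex by (auto simp: dir_def shift_segment_def prod_eq_iff)
  have "translate v d = decorate D j"
    unfolding C_segment(2) translate_decorate decorate_def[of D] current following previous ..
  then show ?thesis unfolding decorated_segments_eq using D_segment(1) by blast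
qed

end

lemma lattice_point_near:
  fixes z :: "real \<times> real"
  shows "\<exists>l\<in>Lam n. dist z (real_point l) \<le> 2 * 2 ^ n"
proof -
  let ?l = "(2 ^ n * \<lfloor>fst z / 2 ^ n\<rfloor>, 2 ^ n * \<lfloor>snd z / 2 ^ n\<rfloor>)"
  have near: "\<bar>t - 2 ^ n * real_of_int \<lfloor>t / 2 ^ n\<rfloor>\<bar> \<le> 2 ^ n" for t :: real
  proof -
    have "t - 2 ^ n * real_of_int \<lfloor>t / 2 ^ n\<rfloor> = 2 ^ n * frac (t / 2 ^ n)"
      by (simp add: frac_def algebra_simps)
    then show ?thesis by (simp add: abs_mult frac_ge_0 less_imp_le[OF frac_lt_1])
  qed
  have "dist z (real_point ?l) \<le>
      dist (fst z) (fst (real_point ?l)) + dist (snd z) (snd (real_point ?l))"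
    unfolding dist_prod_def by (rule sqrt_sum_squares_le_sum) auto
  also have "\<dots> \<le> 2 ^ n + 2 ^ n"
    using near[of "fst z"] near[of "snd z"]
    by (intro add_mono) (simp_all add: real_point_def dist_real_def)
  finally show ?thesis using scaled_in_Lam by (intro bexI[of _ ?l]) simp_all
qed

lemma vertices_translate_in_cball:
  assumes l_near: "dist z (real_point l) \<le> r"
    and bound: "\<And>q. q \<in> vertices d \<Longrightarrow> norm (real_point q) \<le> R"
  shows "real_point ` vertices (translate (v + l) d) \<subseteq> cball z (r + norm (real_point v) + R)"
proof
  have add: "real_point (p + q) = real_point p + real_point q" for p q by (simp add: real_point_def)
  fix x assume "x \<in> real_point ` vertices (translate (v + l) d)"
  then obtain q where q_vertex: "q \<in> vertices d"
    and x_eq: "x = real_point l + (real_point v + real_point q)"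
    unfolding vertices_translate by (auto simp: add algebra_simps)
  have "dist z x \<le> dist z (real_point l) + norm (real_point v + real_point q)"
    unfolding x_eq dist_norm
    using norm_triangle_ineq4[of "z - real_point l" "real_point v + real_point q"]
    by (simp add: algebra_simps)
  also have "\<dots> \<le> r + (norm (real_point v) + R)"
    using l_near bound[OF q_vertex] norm_triangle_ineq[of "real_point v" "real_point q"]
    by (intro add_mono) linarith+
  finally show "x \<in> cball z (r + norm (real_point v) + R)" by simp
qed

theorem (in compatible_covering) satisfies_local_isomorphism_property:
  "local_isomorphism_property \<C>"
  unfolding local_isomorphism_property_def
proof (intro allI impI)
  fix F assume pattern: "finite F \<and> F \<subseteq> decorated_segments \<C>"
  have "finite (\<Union>d\<in>F. support (fst d))" using pattern by (simp add: support_def)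
  then obtain v N where period: "\<And>l. l \<in> Lam N \<Longrightarrow> v + l \<in> Lam (Suc 0)"
    "\<And>l x. l \<in> Lam N \<Longrightarrow> x \<in> (\<Union>d\<in>F. support (fst d)) \<Longrightarrow> turn_at (v + l + x) = turn_at x"
    using periodic_turns by metis
  have "finite (vertices d)" if "d \<in> F" for d
    using pattern that unfolding decorated_segments_eq by (auto simp: decorate_def support_def)
  then have "bounded (real_point ` (\<Union>d\<in>F. vertices d))"
    using pattern by (intro finite_imp_bounded) blast
  then obtain R where bound: "0 < R" "\<And>q d. d \<in> F \<Longrightarrow> q \<in> vertices d \<Longrightarrow> norm (real_point q) \<le> R"
    unfolding bounded_pos by blast
  let ?r = "2 * 2 ^ N + norm (real_point v) + R"
  have "0 < ?r" using bound(1) by (simp add: add_nonneg_pos)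
  moreover have "\<exists>u. translate u ` F \<subseteq> decorated_segments \<C> \<and>
      (\<forall>d\<in>translate u ` F. real_point ` vertices d \<subseteq> cball z ?r)" for z
  proof -
    obtain l where l_near: "l \<in> Lam N" "dist z (real_point l) \<le> 2 * 2 ^ N"
      using lattice_point_near by blast
    have "translate (v + l) d \<in> decorated_segments \<C>" if "d \<in> F" for d
      using pattern that period[OF l_near(1)] by (intro translate_decorated_segment) blast+
    moreover have "real_point ` vertices (translate (v + l) d) \<subseteq> cball z ?r" if "d \<in> F" for d
      using bound(2)[OF that] by (rule vertices_translate_in_cball[OF l_near(2)])
    ultimately show ?thesis by blast
  qed
  ultimately show "\<exists>r>0. \<forall>z. \<exists>v. translate v ` F \<subseteq> decorated_segments \<C> \<and>
      (\<forall>d\<in>translate v ` F. real_point ` vertices d \<subseteq> cball z r)" by blast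
qed

theorem theorem3p5:
  fixes \<C> :: "(int \<Rightarrow> segment) set"
  assumes "covering \<C>"
  shows "local_isomorphism_property \<C> \<longleftrightarrow>
    ((\<forall>C\<in>\<C>. type_H C) \<or> (\<forall>C\<in>\<C>. type_V C)) \<and>
    (\<forall>C\<in>\<C>. \<forall>D\<in>\<C>. \<forall>k. E_curve k C = E_curve k D) \<and>
    (\<forall>C\<in>\<C>. \<forall>D\<in>\<C>. locally_isomorphic (assoc_seq C) (assoc_seq D))"
proof -
  interpret curve_covering \<C> using assms by unfold_locales
  have "type_V C \<longleftrightarrow> \<not> type_H C" if "C \<in> \<C>" for C
    using folding_curve.type_V_iff[OF folding_curve[OF that]] .
  then have types: "(\<forall>C\<in>\<C>. type_H C) \<or> (\<forall>C\<in>\<C>. type_V C) \<longleftrightarrow> (\<forall>C\<in>\<C>. \<forall>D\<in>\<C>. type_H C = type_H D)"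
    by blast
  have "local_isomorphism_property \<C> \<longleftrightarrow> (\<forall>C\<in>\<C>. \<forall>D\<in>\<C>. compatible C D)"
  proof
    assume "\<forall>C\<in>\<C>. \<forall>D\<in>\<C>. compatible C D"
    then interpret compatible_covering \<C> by unfold_locales blast
    show "local_isomorphism_property \<C>" by (rule satisfies_local_isomorphism_property)
  qed (use local_isomorphism_property_imp_compatible in blast)
  then show ?thesis unfolding types compatible_def locally_isomorphic_def by blast
qed

end
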